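(* There exists a self-adjoint almost periodic elliptic operator $\mathcal{L}u=(A(x)u')'+c(x)u$ on $\mathbb{R}$ (dimension $N=1$) which is subcritical, whose generalised principal eigenvalue is $\lambda_1=0$, but which admits a limit operator $\mathcal{L}^*$ that is critical.
   Context: Here $A,c:\mathbb{R}\to\mathbb{R}$ are measurable and bounded, $A$ is smooth and $\inf_{\mathbb{R}} A>0$. Functions involved in differential equalities or inequalities are understood to be real-valued, to belong to $W^{2,1}_{loc}(\mathbb{R})$, and to satisfy the relation almost everywhere. "Positive" means $>0$ everywhere on $\mathbb{R}$. A function $f:\mathbb{R}\to\mathbb{R}$ is almost periodic if from any sequence $(x_n)_{n\in\mathbb{N}}$ in $\mathbb{R}$ one can extract a subsequence $(x_{n_k})_{k\in\mathbb{N}}$ such that $(f(x+x_{n_k}))_{k\in\mathbb{N}}$ converges uniformly in $x\in\mathbb{R}$. The operator $\mathcal{L}$ is almost periodic if its coefficients $A$ and $c$ are almost periodic functions. The generalised principal eigenvalue of $-\mathcal{L}$ is $$\lambda_1:=\sup\{\lambda\in\mathbb{R}\ :\ \exists\,\phi>0,\ -\mathcal{L}\phi\geq\lambda\phi\text{ on }\mathbb{R}\}.$$ An elliptic operator $\mathcal{L}$ on $\mathbb{R}$ is: supercritical if the set of positive solutions of $\mathcal{L}u=0$ is empty; critical if the set of positive functions satisfying $\mathcal{L}u\leq 0$ is one-dimensional (that is, it is non-empty and any two of its elements are scalar multiples of one another); subcritical in the other cases. A limit operator associated with $\mathcal{L}u=(A(x)u')'+c(x)u$ is an operator of the form $\mathcal{L}^*u=(A^*(x)u')'+c^*(x)u$,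 where $A^*(x)$ and $c^*(x)$ are the pointwise limits of $A(x+x_n)$ and $c(x+x_n)$ respectively as $n\to\infty$, for a given sequence $(x_n)_{n\in\mathbb{N}}$ in $\mathbb{R}$. *)

theory Defs
  imports "HOL-Analysis.Analysis"
begin

definition smooth :: "(real \<Rightarrow> real) \<Rightarrow> bool" where
  "smooth f \<longleftrightarrow> (\<forall>n. (deriv ^^ n) f differentiable_on UNIV)"

definition locally_integrable :: "(real \<Rightarrow> real) \<Rightarrow> bool" where
  "locally_integrable f \<longleftrightarrow> (\<forall>a b. f absolutely_integrable_on {a..b})"

definition test_function :: "(real \<Rightarrow> real) \<Rightarrow> bool" where
  "test_function \<eta> \<longleftrightarrow> smooth \<eta> \<and> compact (closure {x. \<eta> x \<noteq> 0})"

definition has_weak_deriv :: "(real \<Rightarrow> real) \<Rightarrow> (real \<Rightarrow> real) \<Rightarrow> bool" where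
  "has_weak_deriv u v \<longleftrightarrow> locally_integrable u \<and> locally_integrable v \<and>
     (\<forall>\<eta>. test_function \<eta> \<longrightarrow>
        (LINT x|lebesgue. u x * deriv \<eta> x) = - (LINT x|lebesgue. v x * \<eta> x))"

text \<open>A weak derivative is unique up to a null set, so the choice below is immaterial for
  relations that are only required to hold almost everywhere.\<close>

definition weak_deriv :: "(real \<Rightarrow> real) \<Rightarrow> real \<Rightarrow> real" where
  "weak_deriv u = (SOME v. has_weak_deriv u v)"

text \<open>The space \<open>W\<^sup>2\<^sup>,\<^sup>1\<close> (local) on the real line. Its elements are classes of functions modulo
  null sets, each with exactly one continuous representative; the set below consists of these
  representatives, so that pointwise conditions such as positivity everywhere make sense.\<close>

definition W21_loc :: "(real \<Rightarrow> real) set" where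
  "W21_loc = {u. continuous_on UNIV u \<and> (\<exists>v w. has_weak_deriv u v \<and> has_weak_deriv v w)}"

text \<open>The operator \<open>u \<mapsto> (A u')' + c u\<close>, represented by its pair of coefficients.\<close>

definition elliptic_operator :: "(real \<Rightarrow> real) \<Rightarrow> (real \<Rightarrow> real) \<Rightarrow> bool" where
  "elliptic_operator A c \<longleftrightarrow>
     A \<in> borel_measurable lebesgue \<and> c \<in> borel_measurable lebesgue \<and>
     bounded (range A) \<and> bounded (range c) \<and> smooth A \<and> (INF x. A x) > 0"

definition op_L :: "(real \<Rightarrow> real) \<Rightarrow> (real \<Rightarrow> real) \<Rightarrow> (real \<Rightarrow> real) \<Rightarrow> real \<Rightarrow> real" where
  "op_L A c u = (\<lambda>x. weak_deriv (\<lambda>y. A y * weak_deriv u y) x + c x * u x)"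

definition positive_solutions :: "(real \<Rightarrow> real) \<Rightarrow> (real \<Rightarrow> real) \<Rightarrow> (real \<Rightarrow> real) set" where
  "positive_solutions A c =
     {u \<in> W21_loc. (\<forall>x. u x > 0) \<and> (AE x in lebesgue. op_L A c u x = 0)}"

definition positive_supersolutions :: "(real \<Rightarrow> real) \<Rightarrow> (real \<Rightarrow> real) \<Rightarrow> (real \<Rightarrow> real) set" where
  "positive_supersolutions A c =
     {u \<in> W21_loc. (\<forall>x. u x > 0) \<and> (AE x in lebesgue. op_L A c u x \<le> 0)}"

definition supercritical :: "(real \<Rightarrow> real) \<Rightarrow> (real \<Rightarrow> real) \<Rightarrow> bool" where
  "supercritical A c \<longleftrightarrow> positive_solutions A c = {}"

definition critical :: "(real \<Rightarrow> real) \<Rightarrow> (real \<Rightarrow> real) \<Rightarrow> bool" where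
  "critical A c \<longleftrightarrow> positive_supersolutions A c \<noteq> {} \<and>
     (\<forall>u\<in>positive_supersolutions A c. \<forall>v\<in>positive_supersolutions A c.
        \<exists>k::real. \<forall>x. v x = k * u x)"

definition subcritical :: "(real \<Rightarrow> real) \<Rightarrow> (real \<Rightarrow> real) \<Rightarrow> bool" where
  "subcritical A c \<longleftrightarrow> \<not> supercritical A c \<and> \<not> critical A c"

text \<open>The supremum is taken in the extended reals, so that a finite value really is a least upper
  bound (on \<open>real\<close>, \<open>Sup\<close> is unspecified for empty or unbounded sets).\<close>

definition principal_eigenvalue :: "(real \<Rightarrow> real) \<Rightarrow> (real \<Rightarrow> real) \<Rightarrow> ereal" where
  "principal_eigenvalue A c = Sup (ereal ` {\<mu>. \<exists>\<phi>\<in>W21_loc. (\<forall>x. \<phi> x > 0) \<and>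
     (AE x in lebesgue. - op_L A c \<phi> x \<ge> \<mu> * \<phi> x)})"

definition almost_periodic :: "(real \<Rightarrow> real) \<Rightarrow> bool" where
  "almost_periodic f \<longleftrightarrow> (\<forall>X :: nat \<Rightarrow> real. \<exists>r :: nat \<Rightarrow> nat. strict_mono r \<and>
     (\<exists>g. uniform_limit UNIV (\<lambda>k x. f (x + X (r k))) g sequentially))"

definition almost_periodic_operator :: "(real \<Rightarrow> real) \<Rightarrow> (real \<Rightarrow> real) \<Rightarrow> bool" where
  "almost_periodic_operator A c \<longleftrightarrow> almost_periodic A \<and> almost_periodic c"

definition limit_operator ::
    "(real \<Rightarrow> real) \<Rightarrow> (real \<Rightarrow> real) \<Rightarrow> (real \<Rightarrow> real) \<Rightarrow> (real \<Rightarrow> real) \<Rightarrow> bool" where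
  "limit_operator A c A' c' \<longleftrightarrow> (\<exists>X :: nat \<Rightarrow> real. \<forall>x.
     (\<lambda>n. A (x + X n)) \<longlonglongrightarrow> A' x \<and> (\<lambda>n. c (x + X n)) \<longlonglongrightarrow> c' x)"

end

theory Submission
  imports Defs
begin

text \<open>Take \<open>A = 1\<close> and \<open>c = - (P'' + P'\<^sup>2)\<close>, so that \<open>exp P\<close> is a positive solution. With
  \<open>P x = (\<Sum>k. 4 * 2^k * (1 - cos (pi x / 3^k)))\<close> both \<open>P'\<close> and \<open>P''\<close> are uniform limits of
  periodic functions, hence \<open>c\<close> is almost periodic, while \<open>P\<close> itself grows fast enough for
  \<open>exp (- 2 P)\<close> to be integrable: then \<open>exp P \<cdot> (C + \<integral> exp (- 2 P))\<close> is a second positive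
  solution. Translation by \<open>3^n\<close> shifts the \<open>k\<close>-th angle by an odd multiple of \<open>pi\<close>
  for every \<open>k \<le> n\<close>, so \<open>P'\<close> turns into \<open>- P'\<close> in the limit, the limit operator has
  the solution \<open>exp (- P)\<close>, and \<open>exp (2 P)\<close> is not integrable on either side. Finally
  \<open>\<lambda>\<^sub>1 = 0\<close> because \<open>P'\<close> has zero mean.\<close>

section \<open>Smooth bump functions\<close>

text \<open>The zero mean of \<open>P'\<close> has to coexist with an unbounded primitive: if
  \<open>P\<close> were bounded, \<open>exp (- 2 P)\<close> would be integrable on neither side and
  the operator itself would be critical. Hence the diverging amplitudes \<open>2^k\<close>, against
  angles so slow that each derivative gains a factor of order \<open>3^(-k)\<close>, which leaves
  the summable ratios \<open>2/3\<close> and \<open>2/9\<close>. The base 3 is odd, so all powers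
  \<open>3^(n-k)\<close> are odd and one translation reverses every angle of index up to
  \<open>n\<close>. The factor 4 lets one single term of \<open>P\<close> push
  \<open>exp (2 P)\<close> above the order of \<open>x^2\<close>. The obstacle is that criticality
  and the bound \<lambda>_1 \<le> 0 concern all supersolutions in W^{2,1}, whose second derivative
  exists only weakly. They are first shown to be C^1, with a one-sided integrated inequality for the
  derivative; comparison arguments then run on first derivatives alone.\<close>

definition flat_poly :: "real poly \<Rightarrow> real \<Rightarrow> real" where
  "flat_poly q t = (if t > 0 then poly q (1 / t) * exp (- (1 / t)) else 0)"

lemma poly_times_exp_minus_tendsto_0:
  "((\<lambda>s::real. poly q s * exp (- s)) \<longlongrightarrow> 0) at_top"
proof -
  have "((\<lambda>s::real. \<Sum>i\<le>degree q. coeff q i * (s ^ i / exp s)) \<longlongrightarrow> (\<Sum>i\<le>degree q. coeff q i * 0)) at_top"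
    by (intro tendsto_sum tendsto_mult tendsto_const tendsto_power_div_exp_0)
  then show ?thesis
    by (simp add: poly_altdef exp_minus sum_distrib_right divide_inverse mult.assoc)
qed

text \<open>With \<open>s = 1/t\<close>, the derivative of \<open>q(s) exp(-s)\<close> in
  \<open>t\<close> is \<open>s^2 (q - q')(s) exp(-s)\<close>; \<open>[:0, 0, 1:]\<close> is this
  \<open>s^2\<close>. At 0 the difference quotient is \<open>s q(s) exp(-s)\<close>, which tends to
  0 as \<open>s\<close> grows. The closure under differentiation is why \<open>flat_poly\<close>
  carries a polynomial.\<close>

lemma flat_poly_deriv:
  "(flat_poly q has_real_derivative flat_poly ([:0, 0, 1:] * (q - pderiv q)) t) (at t)"
proof -
  consider "t > 0" | "t < 0" | "t = 0" by linarith
  then show ?thesis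
  proof cases
    case 1
    have "((\<lambda>t. poly q (1 / t) * exp (- (1 / t))) has_real_derivative
        flat_poly ([:0, 0, 1:] * (q - pderiv q)) t) (at t)"
      using 1 by (auto intro!: derivative_eq_intros DERIV_chain2[OF poly_DERIV]
          simp: flat_poly_def field_simps power2_eq_square)
    then show ?thesis
      by (rule has_field_derivative_transform_within_open[where S="{0<..}"])
        (use 1 in \<open>auto simp: flat_poly_def\<close>)
  next
    case 2
    have "((\<lambda>t. 0) has_real_derivative flat_poly ([:0, 0, 1:] * (q - pderiv q)) t) (at t)"
      using 2 by (simp add: flat_poly_def)
    then show ?thesis
      by (rule has_field_derivative_transform_within_open[where S="{..<0}"])
        (use 2 in \<open>auto simp: flat_poly_def\<close>)
  next
    case 3
    have "((\<lambda>h. poly ([:0, 1:] * q) (inverse h) * exp (- inverse h)) \<longlongrightarrow> 0) (at_right (0::real))"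
      by (rule filterlim_compose[OF poly_times_exp_minus_tendsto_0 filterlim_inverse_at_top_right])
    moreover have "\<forall>\<^sub>F h in at_right (0::real). poly ([:0, 1:] * q) (inverse h) * exp (- inverse h) = flat_poly q h / h"
      using eventually_at_right_less[of "0::real"]
      by eventually_elim (auto simp: flat_poly_def field_simps)
    ultimately have r: "((\<lambda>h. flat_poly q h / h) \<longlongrightarrow> 0) (at_right 0)"
      by (rule Lim_transform_eventually)
    have "\<forall>\<^sub>F h in at_left (0::real). 0 = flat_poly q h / h"
      by (auto simp: flat_poly_def eventually_at_filter)
    then have l: "((\<lambda>h. flat_poly q h / h) \<longlongrightarrow> 0) (at_left 0)"
      by (rule Lim_transform_eventually[OF tendsto_const])
    have "((\<lambda>h. flat_poly q h / h) \<longlongrightarrow> 0) (at 0)"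
      by (rule filterlim_split_at[OF l r])
    then show ?thesis
      using 3 by (simp add: DERIV_def flat_poly_def)
  qed
qed

lemma smooth_flat_poly: "smooth (flat_poly q)"
proof -
  have "\<exists>r. (deriv ^^ n) (flat_poly q) = flat_poly r" for n
  proof (induction n)
    case (Suc n)
    then obtain r where "(deriv ^^ n) (flat_poly q) = flat_poly r" by blast
    moreover have "deriv (flat_poly r) = flat_poly ([:0, 0, 1:] * (r - pderiv r))"
      using DERIV_imp_deriv[OF flat_poly_deriv] by blast
    ultimately show ?case by auto
  qed auto
  then show ?thesis
    unfolding smooth_def differentiable_on_def
    by (metis flat_poly_deriv has_field_derivative_def differentiable_def)
qed

section \<open>Calculus of smooth functions\<close>

lemma smooth_iff: "smooth f \<longleftrightarrow> f differentiable_on UNIV \<and> smooth (deriv f)"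
proof
  assume *: "smooth f"
  show "f differentiable_on UNIV \<and> smooth (deriv f)"
  proof
    show "f differentiable_on UNIV" using *[unfolded smooth_def, rule_format, of 0] by simp
    show "smooth (deriv f)" unfolding smooth_def
      using *[unfolded smooth_def, rule_format, of "Suc n" for n]
      by (simp add: funpow_Suc_right del: funpow.simps)
  qed
next
  assume *: "f differentiable_on UNIV \<and> smooth (deriv f)"
  have "(deriv ^^ n) f differentiable_on UNIV" for n
    using * by (cases n) (auto simp: smooth_def funpow_Suc_right simp del: funpow.simps(2))
  then show "smooth f" by (simp add: smooth_def)
qed

lemma smooth_DERIV: "smooth f \<Longrightarrow> (f has_real_derivative deriv f x) (at x)"
  by (metis smooth_iff differentiable_on_def UNIV_I DERIV_deriv_iff_real_differentiable)

lemma smooth_deriv: "smooth f \<Longrightarrow> smooth (deriv f)"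
  using smooth_iff by blast

lemma smooth_continuous_on: "smooth f \<Longrightarrow> continuous_on S f"
  by (meson DERIV_isCont continuous_at_imp_continuous_on smooth_DERIV)

text \<open>Off by one: \<open>C_n n\<close> asks for \<open>n + 1\<close> derivatives.\<close>

definition C_n :: "nat \<Rightarrow> (real \<Rightarrow> real) \<Rightarrow> bool" where
  "C_n n f \<longleftrightarrow> (\<forall>k\<le>n. (deriv ^^ k) f differentiable_on UNIV)"

lemma smooth_iff_C_n: "smooth f \<longleftrightarrow> (\<forall>n. C_n n f)"
  by (auto simp: smooth_def C_n_def)

lemma C_n_0: "C_n 0 f \<longleftrightarrow> f differentiable_on UNIV"
  by (simp add: C_n_def)

lemma C_n_Suc: "C_n (Suc n) f \<longleftrightarrow> f differentiable_on UNIV \<and> C_n n (deriv f)"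
proof -
  have "(\<forall>k\<le>Suc n. Q k) \<longleftrightarrow> Q 0 \<and> (\<forall>k\<le>n. Q (Suc k))" for Q :: "nat \<Rightarrow> bool"
    by (metis Suc_le_mono le0 not0_implies_Suc)
  then show ?thesis
    by (simp add: C_n_def funpow_Suc_right del: funpow.simps(2))
qed

lemma C_n_imp_differentiable: "C_n n f \<Longrightarrow> f differentiable_on UNIV"
  by (cases n) (auto simp: C_n_0 C_n_Suc)

lemma C_n_mono: "C_n (Suc n) f \<Longrightarrow> C_n n f"
  by (auto simp: C_n_def)

lemma C_n_DERIV: "C_n n f \<Longrightarrow> (f has_real_derivative deriv f x) (at x)"
  by (metis C_n_imp_differentiable differentiable_on_def UNIV_I DERIV_deriv_iff_real_differentiable)

lemma C_n_SucI:
  assumes "\<And>x. (f has_real_derivative g x) (at x)" "C_n n g"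
  shows "C_n (Suc n) f"
proof -
  have "deriv f = g" using assms(1) DERIV_imp_deriv by blast
  moreover have "f differentiable_on UNIV"
    using assms(1) by (auto simp: differentiable_on_def real_differentiable_def)
  ultimately show ?thesis using assms(2) by (simp add: C_n_Suc)
qed

lemma C_n_lincomb: "C_n n f \<Longrightarrow> C_n n g \<Longrightarrow> C_n n (\<lambda>x. a * f x + b * g x)"
proof (induction n arbitrary: f g)
  case 0
  then show ?case by (auto simp: C_n_0 intro!: differentiable_on_add differentiable_on_mult)
next
  case (Suc n)
  have "((\<lambda>x. a * f x + b * g x) has_real_derivative a * deriv f x + b * deriv g x) (at x)" for x
    by (intro DERIV_add DERIV_cmult C_n_DERIV[OF Suc.prems(1)] C_n_DERIV[OF Suc.prems(2)])
  then show ?case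
    using Suc by (intro C_n_SucI) (auto simp: C_n_Suc)
qed

text \<open>The derivative of a product consists of products again, so \<open>smooth\<close> by
  itself offers nothing to induct on; with a bounded order, \<open>f' g\<close> and
  \<open>f g'\<close> fall under the induction hypothesis.\<close>

lemma C_n_mult: "C_n n f \<Longrightarrow> C_n n g \<Longrightarrow> C_n n (\<lambda>x. f x * g x)"
proof (induction n arbitrary: f g)
  case 0
  then show ?case by (auto simp: C_n_0 intro!: differentiable_on_mult)
next
  case (Suc n)
  \<comment> \<open>The factors \<open>1\<close> give the derivative the shape of
    \<open>C_n_lincomb\<close>.\<close>
  have "((\<lambda>x. f x * g x) has_real_derivative 1 * (deriv f x * g x) + 1 * (f x * deriv g x)) (at x)" for x
    using DERIV_mult[OF C_n_DERIV[OF Suc.prems(1)] C_n_DERIV[OF Suc.prems(2)]]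
    by (simp add: mult_ac add.commute)
  moreover have "C_n n (\<lambda>x. 1 * (deriv f x * g x) + 1 * (f x * deriv g x))"
    using Suc.prems by (intro C_n_lincomb Suc.IH) (auto simp: C_n_mono C_n_Suc intro: C_n_mono)
  ultimately show ?case by (rule C_n_SucI)
qed

text \<open>The outer factor \<open>k\<close> is there for the induction: every differentiation
  multiplies it by \<open>m\<close>.\<close>

lemma C_n_affine: "C_n n f \<Longrightarrow> C_n n (\<lambda>x. k * f (m * x + b))"
proof (induction n arbitrary: f k)
  case 0
  have "((\<lambda>x. k * f (m * x + b)) has_real_derivative k * m * deriv f (m * x + b)) (at x)" for x
    by (auto intro!: derivative_eq_intros DERIV_chain2[OF C_n_DERIV[OF 0]])
  then show ?case
    unfolding C_n_0 differentiable_on_def real_differentiable_def by blast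
next
  case (Suc n)
  have "((\<lambda>x. k * f (m * x + b)) has_real_derivative k * m * deriv f (m * x + b)) (at x)" for x
    by (auto intro!: derivative_eq_intros DERIV_chain2[OF C_n_DERIV[OF Suc.prems]])
  then show ?case using Suc by (intro C_n_SucI) (auto simp: C_n_Suc)
qed

lemma smooth_lincomb: "smooth f \<Longrightarrow> smooth g \<Longrightarrow> smooth (\<lambda>x. a * f x + b * g x)"
  using C_n_lincomb by (simp add: smooth_iff_C_n)

lemma smooth_mult: "smooth f \<Longrightarrow> smooth g \<Longrightarrow> smooth (\<lambda>x. f x * g x)"
  using C_n_mult by (simp add: smooth_iff_C_n)

lemma smooth_affine: "smooth f \<Longrightarrow> smooth (\<lambda>x. f (m * x + b))"
  using C_n_affine[of _ f 1] by (simp add: smooth_iff_C_n)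

lemma smooth_const: "smooth (\<lambda>x. k)"
proof -
  have "(deriv ^^ n) (\<lambda>x::real. k) = (\<lambda>x. if n = 0 then k else 0)" for n
    by (induction n) auto
  then show ?thesis by (simp add: smooth_def)
qed

section \<open>Test functions and bumps\<close>

lemma test_functionI:
  assumes "smooth \<eta>" "\<And>x. x \<notin> {a..b} \<Longrightarrow> \<eta> x = 0"
  shows "test_function \<eta>"
proof -
  have "{x. \<eta> x \<noteq> 0} \<subseteq> {a..b}" using assms(2) by blast
  then have "bounded {x. \<eta> x \<noteq> 0}" using bounded_closed_interval bounded_subset by blast
  then show ?thesis using assms(1) by (simp add: test_function_def)
qed

lemma test_function_support:
  assumes "test_function \<eta>"
  obtains R where "R > 0" "\<And>x. \<bar>x\<bar> \<ge> R \<Longrightarrow> \<eta> x = 0" "\<And>x. \<bar>x\<bar> \<ge> R \<Longrightarrow> deriv \<eta> x = 0"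
proof -
  have "bounded {x. \<eta> x \<noteq> 0}"
    using assms by (auto simp: test_function_def)
  then obtain R where R: "R > 0" "\<forall>x\<in>{x. \<eta> x \<noteq> 0}. norm x \<le> R"
    by (meson bounded_pos)
  then have z: "\<eta> x = 0" if "\<bar>x\<bar> > R" for x using that by force
  have "deriv \<eta> x = 0" if "\<bar>x\<bar> > R" for x
  proof -
    have "open {x::real. \<bar>x\<bar> > R}" by (intro open_Collect_less continuous_intros)
    then have "(\<eta> has_real_derivative 0) (at x)"
      by (rule has_field_derivative_transform_within_open[OF DERIV_const[of 0]])
         (use that z in auto)
    then show ?thesis by (rule DERIV_imp_deriv)
  qed
  \<comment> \<open>Both zeros were obtained for \<open>\<bar>x\<bar> > R\<close>, an open set; the
    larger radius gives the non-strict bounds.\<close>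
  with z R(1) show ?thesis by (intro that[of "R + 1"]) auto
qed

lemma test_function_deriv: "test_function \<eta> \<Longrightarrow> test_function (deriv \<eta>)"
proof -
  assume \<eta>: "test_function \<eta>"
  obtain R where "\<And>x. \<bar>x\<bar> \<ge> R \<Longrightarrow> deriv \<eta> x = 0"
    using test_function_support[OF \<eta>] by metis
  then show "test_function (deriv \<eta>)"
    using \<eta> by (intro test_functionI[where a="-R" and b=R]) (auto simp: test_function_def smooth_deriv)
qed

lemma test_function_lincomb:
  assumes "test_function f" "test_function g"
  shows "test_function (\<lambda>x. a * f x + b * g x)"
proof -
  obtain R where R: "\<And>x. \<bar>x\<bar> \<ge> R \<Longrightarrow> f x = 0" using test_function_support[OF assms(1)] by metis
  obtain S where S: "\<And>x. \<bar>x\<bar> \<ge> S \<Longrightarrow> g x = 0" using test_function_support[OF assms(2)] by metis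
  show ?thesis
    by (rule test_functionI[where a="- max R S" and b="max R S"])
      (use assms R S in \<open>auto simp: test_function_def intro!: smooth_lincomb\<close>)
qed

text \<open>\<open>m\<close> is a sharpness: as \<open>m\<close> grows, both factors tend to 1
  inside the interval, so the bumps approximate the indicator of the open interval from
  \<open>a\<close> to \<open>b\<close> from below.\<close>

definition bump :: "real \<Rightarrow> real \<Rightarrow> real \<Rightarrow> real \<Rightarrow> real" where
  "bump m a b x = flat_poly 1 (m * x + - (m * a)) * flat_poly 1 (- m * x + m * b)"

lemma bump_zero: "m > 0 \<Longrightarrow> x \<notin> {a..b} \<Longrightarrow> bump m a b x = 0"
  by (auto simp: bump_def flat_poly_def)

lemma smooth_bump: "smooth (bump m a b)"
  unfolding bump_def[abs_def] by (intro smooth_mult smooth_affine smooth_flat_poly)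

lemma test_function_bump: "m > 0 \<Longrightarrow> test_function (bump m a b)"
  using test_functionI[OF smooth_bump bump_zero] .

lemma bump_nonneg: "bump m a b x \<ge> 0"
  by (simp add: bump_def flat_poly_def)

lemma bump_le_1: "bump m a b x \<le> 1"
  unfolding bump_def by (rule mult_le_one) (auto simp: flat_poly_def)

lemma bump_pos: "m > 0 \<Longrightarrow> a < x \<Longrightarrow> x < b \<Longrightarrow> bump m a b x > 0"
  by (auto simp: bump_def flat_poly_def)

lemma bump_tendsto:
  assumes "a < x" "x < b"
  shows "(\<lambda>n. bump (real (Suc n)) a b x) \<longlonglongrightarrow> 1"
proof -
  have *: "(\<lambda>n. flat_poly 1 (real (Suc n) * d)) \<longlonglongrightarrow> 1" if "d > 0" for d
  proof -
    have "(\<lambda>n. exp (- (inverse (real (Suc n)) * inverse d))) \<longlonglongrightarrow> exp (- (0 * inverse d))"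
      by (intro tendsto_intros LIMSEQ_inverse_real_of_nat)
    then show ?thesis using that by (simp add: flat_poly_def field_simps del: of_nat_Suc)
  qed
  have "(\<lambda>n. flat_poly 1 (real (Suc n) * (x - a)) * flat_poly 1 (real (Suc n) * (b - x))) \<longlonglongrightarrow> 1 * 1"
    using assms by (intro tendsto_mult *) auto
  then show ?thesis by (simp add: bump_def algebra_simps)
qed

section \<open>Weak derivatives on the line\<close>

lemma locally_integrable_integrable:
  assumes "locally_integrable f"
  shows "integrable lebesgue (\<lambda>x. indicator {a..b} x * f x)"
  using assms by (simp add: locally_integrable_def set_integrable_def)

lemma locally_integrable_measurable:
  assumes "locally_integrable f"
  shows "f \<in> borel_measurable lebesgue"
proof (rule borel_measurable_LIMSEQ_real)
  show "(\<lambda>x. indicator {- real n..real n} x * f x) \<in> borel_measurable lebesgue" for n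
    using locally_integrable_integrable[OF assms] by (rule borel_measurable_integrable)
  show "(\<lambda>n. indicator {- real n..real n} x * f x) \<longlonglongrightarrow> f x" for x
  proof (rule tendsto_eventually)
    obtain N where "\<bar>x\<bar> \<le> real N" using real_arch_simple by blast
    then show "\<forall>\<^sub>F n in sequentially. indicator {- real n..real n} x * f x = f x"
      by (intro eventually_sequentiallyI[of N]) (auto simp: indicator_def)
  qed
qed

lemma locally_integrable_continuous: "continuous_on UNIV f \<Longrightarrow> locally_integrable f"
  unfolding locally_integrable_def
  by (meson absolutely_integrable_continuous_real continuous_on_subset subset_UNIV)

lemma locally_integrable_lincomb:
  "locally_integrable f \<Longrightarrow> locally_integrable g \<Longrightarrow> locally_integrable (\<lambda>x. a * f x + b * g x)"
  unfolding locally_integrable_def by (auto intro!: set_integral_add set_integrable_mult_right)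

lemma locally_integrable_cong_AE:
  assumes "locally_integrable f" "AE x in lebesgue. f x = g x"
  shows "locally_integrable g"
  unfolding locally_integrable_def set_integrable_def
proof (intro allI)
  fix a b :: real
  have g: "g \<in> borel_measurable lebesgue"
    using locally_integrable_measurable[OF assms(1)] assms(2) by (rule borel_measurable_AE)
  show "integrable lebesgue (\<lambda>x. indicat_real {a..b} x *\<^sub>R g x)"
  proof (rule integrable_cong_AE_imp)
    show "integrable lebesgue (\<lambda>x. indicator {a..b} x * f x)"
      using locally_integrable_integrable[OF assms(1)] .
    show "(\<lambda>x. indicat_real {a..b} x *\<^sub>R g x) \<in> borel_measurable lebesgue"
      using g by (auto intro!: borel_measurable_times borel_measurable_indicator)
    show "AE x in lebesgue. indicator {a..b} x * f x = indicat_real {a..b} x *\<^sub>R g x"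
      using assms(2) by eventually_elim simp
  qed
qed

lemma continuous_lebesgue_measurable:
  "continuous_on UNIV (f :: real \<Rightarrow> real) \<Longrightarrow> f \<in> borel_measurable lebesgue"
  by (simp add: borel_measurable_continuous_onI measurable_completion)

lemma integrable_locally_integrable_times:
  assumes f: "locally_integrable f" and g: "continuous_on UNIV g"
    and 0: "\<And>x. \<bar>x\<bar> \<ge> R \<Longrightarrow> g x = 0"
  shows "integrable lebesgue (\<lambda>x. f x * g x)"
proof -
  have "compact (g ` {-R..R})"
    by (intro compact_continuous_image continuous_on_subset[OF g]) auto
  then obtain B where B: "\<And>x. x \<in> {-R..R} \<Longrightarrow> \<bar>g x\<bar> \<le> B" "B > 0"
    by (metis bounded_pos compact_imp_bounded imageI real_norm_def)
  show ?thesis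
  proof (rule Bochner_Integration.integrable_bound)
    show "integrable lebesgue (\<lambda>x. B * (indicator {-R..R} x * f x))"
      using locally_integrable_integrable[OF f] by simp
    show "(\<lambda>x. f x * g x) \<in> borel_measurable lebesgue"
      using locally_integrable_measurable[OF f] continuous_lebesgue_measurable[OF g] by measurable
    show "AE x in lebesgue. norm (f x * g x) \<le> norm (B * (indicator {- R..R} x * f x))"
    proof (rule AE_I2)
      fix x show "norm (f x * g x) \<le> norm (B * (indicator {- R..R} x * f x))"
      proof (cases "x \<in> {-R..R}")
        case True
        then show ?thesis using B(1)[OF True] B(2)
          by (simp add: abs_mult) (metis abs_ge_zero mult.commute mult_right_mono)
      next
        case False
        then show ?thesis by (auto simp: 0)
      qed
    qed
  qed
qed

lemma integrable_times_test_function: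
  assumes "locally_integrable f" "test_function \<eta>"
  shows "integrable lebesgue (\<lambda>x. f x * \<eta> x)"
proof -
  obtain R where "\<And>x. \<bar>x\<bar> \<ge> R \<Longrightarrow> \<eta> x = 0" using test_function_support[OF assms(2)] by metis
  then show ?thesis
    using assms integrable_locally_integrable_times smooth_continuous_on test_function_def by blast
qed

section \<open>The fundamental lemma of the calculus of variations\<close>

text \<open>The Borel sets over which \<open>f\<close> integrates to 0 contain the compact intervals
  and are closed under complements and countable disjoint unions, hence are all Borel sets; a
  density with this property is zero.\<close>

lemma AE_zero_if_interval_integrals_zero:
  fixes f :: "real \<Rightarrow> real"
  assumes f: "integrable lborel f"
    and 0: "\<And>a b. a \<le> b \<Longrightarrow> (LINT x:{a..b}|lborel. f x) = 0"
  shows "AE x in lborel. f x = 0"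
proof (rule density_unique_real[OF f])
  show "integrable lborel (\<lambda>x. 0 :: real)" by simp
  have int: "integrable lborel (\<lambda>x. indicat_real A x * f x)" if "A \<in> sets borel" for A
    using integrable_mult_indicator[OF _ f, of A] that by simp
  \<comment> \<open>Needed for complements in the induction: the integral over \<open>-A\<close> is
    the total one minus that over \<open>A\<close>.\<close>
  have total: "(LINT x|lborel. f x) = 0"
  proof (rule LIMSEQ_unique)
    show "(\<lambda>n. LINT x|lborel. indicat_real {- real n..real n} x * f x) \<longlonglongrightarrow> (LINT x|lborel. f x)"
    proof (rule integral_dominated_convergence[where w="\<lambda>x. \<bar>f x\<bar>"])
      show "AE x in lborel. (\<lambda>n. indicat_real {- real n..real n} x * f x) \<longlonglongrightarrow> f x"
      proof (rule AE_I2)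
        fix x :: real
        obtain N where "\<bar>x\<bar> \<le> real N" using real_arch_simple by blast
        then show "(\<lambda>n. indicat_real {- real n..real n} x * f x) \<longlonglongrightarrow> f x"
          by (intro tendsto_eventually eventually_sequentiallyI[of N]) (auto simp: indicator_def)
      qed
    qed (use f in \<open>auto simp: indicator_def\<close>)
    show "(\<lambda>n. LINT x|lborel. indicat_real {- real n..real n} x * f x) \<longlonglongrightarrow> 0"
      using 0 by (simp add: set_lebesgue_integral_def)
  qed
  fix A :: "real set" assume "A \<in> sets lborel"
  then have "A \<in> sets borel" by simp
  then have "(LINT x:A|lborel. f x) = 0"
  proof (induction A rule: borel_set_induct)
    case empty
    show ?case by (simp add: set_lebesgue_integral_def)
  next
    case (interval a b)
    then show ?case by (rule 0)
  next
    case (compl A)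
    have "(LINT x:-A|lborel. f x) = (LINT x|lborel. f x - indicator A x * f x)"
      unfolding set_lebesgue_integral_def by (rule Bochner_Integration.integral_cong) (auto simp: indicator_def)
    also have "\<dots> = (LINT x|lborel. f x) - (LINT x|lborel. indicator A x * f x)"
      by (rule Bochner_Integration.integral_diff[OF f int[OF compl(1)]])
    finally show ?case using total compl(2) by (simp add: set_lebesgue_integral_def)
  next
    case (union A)
    have "(LINT x:(\<Union>i. A i)|lborel. f x) = (\<Sum>i. (LINT x:(A i)|lborel. f x))"
      using union(1,2) int[of "\<Union>i. A i"]
      by (intro lebesgue_integral_countable_add) (auto simp: disjoint_family_on_def set_integrable_def)
    then show ?case using union(3) by simp
  qed
  then show "(LINT x:A|lborel. f x) = (LINT x:A|lborel. 0)"
    by (simp add: set_lebesgue_integral_def)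
qed

text \<open>Weak derivatives are defined with \<open>lebesgue\<close>, while Fubini and the
  induction over Borel sets run on \<open>lborel\<close>; this is the bridge.\<close>

lemma lebesgue_integrable_borel_version:
  fixes f :: "real \<Rightarrow> real"
  assumes "integrable lebesgue f"
  obtains g where "integrable lborel g" "AE x in lebesgue. f x = g x"
proof -
  obtain g where g: "g \<in> borel_measurable lborel" "AE x in lborel. f x = g x"
    using completion_ex_borel_measurable_real[OF borel_measurable_integrable[OF assms]] by blast
  have ae: "AE x in lebesgue. f x = g x" using g(2) by (rule AE_completion)
  have "integrable lebesgue g"
    using integrable_cong_AE_imp[OF assms measurable_completion[OF g(1)]] ae by simp
  then show ?thesis using g ae integrable_completion[OF g(1)] that by blast
qed

text \<open>Bumps of growing sharpness turn test integrals into interval integrals by dominated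
  convergence; the truncations of \<open>f\<close> to \<open>{-n..n}\<close> are then zero by the
  interval criterion.\<close>

lemma AE_zero_if_test_integrals_zero:
  assumes f: "locally_integrable f"
    and 0: "\<And>\<eta>. test_function \<eta> \<Longrightarrow> (LINT x|lebesgue. f x * \<eta> x) = 0"
  shows "AE x in lebesgue. f x = 0"
proof -
  have zero: "(LINT x|lebesgue. indicator {a..b} x * f x) = 0" for a b
  proof (rule LIMSEQ_unique)
    let ?\<eta> = "\<lambda>n. bump (real (Suc n)) a b"
    show "(\<lambda>n. LINT x|lebesgue. f x * ?\<eta> n x) \<longlonglongrightarrow> (LINT x|lebesgue. indicator {a..b} x * f x)"
    proof (rule integral_dominated_convergence[where w="\<lambda>x. \<bar>indicator {a..b} x * f x\<bar>"])
      show "(\<lambda>x. indicat_real {a..b} x * f x) \<in> borel_measurable lebesgue"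
        "integrable lebesgue (\<lambda>x. \<bar>indicator {a..b} x * f x\<bar>)"
        using locally_integrable_integrable[OF f, of a b] by auto
      show "(\<lambda>x. f x * ?\<eta> n x) \<in> borel_measurable lebesgue" for n
        using integrable_times_test_function[OF f test_function_bump] by auto
      show "AE x in lebesgue. norm (f x * ?\<eta> n x) \<le> \<bar>indicator {a..b} x * f x\<bar>" for n
        by (rule AE_I2) (auto simp: indicator_def abs_mult bump_nonneg bump_zero bump_le_1 mult_left_le)
      \<comment> \<open>At the endpoints every bump is 0 but the indicator is 1.\<close>
      have "negligible {a, b}" by simp
      then have "AE x in lebesgue. x \<notin> {a, b}"
        using AE_not_in negligible_iff_null_sets by blast
      then show "AE x in lebesgue. (\<lambda>n. f x * ?\<eta> n x) \<longlonglongrightarrow> indicator {a..b} x * f x"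
      proof eventually_elim
        case (elim x)
        show ?case
        proof (cases "x \<in> {a..b}")
          case True
          then have "(\<lambda>n. f x * ?\<eta> n x) \<longlonglongrightarrow> f x * 1"
            using elim by (intro tendsto_mult tendsto_const bump_tendsto) auto
          then show ?thesis using True by simp
        qed (simp add: bump_zero)
      qed
    qed
    show "(\<lambda>n. LINT x|lebesgue. f x * ?\<eta> n x) \<longlonglongrightarrow> 0"
      using 0[OF test_function_bump] by simp
  qed
  have "AE x in lebesgue. indicator {-real n..real n} x * f x = 0" for n
  proof -
    obtain g where g: "integrable lborel g" "AE x in lebesgue. indicator {-real n..real n} x * f x = g x"
      using lebesgue_integrable_borel_version[OF locally_integrable_integrable[OF f]] by blast
    have "AE x in lborel. g x = 0"
    proof (rule AE_zero_if_interval_integrals_zero[OF g(1)])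
      fix a b :: real
      have gm: "g \<in> borel_measurable lborel" using g(1) by simp
      have "(LINT x:{a..b}|lborel. g x) = (LINT x|lebesgue. indicator {a..b} x * g x)"
        unfolding set_lebesgue_integral_def using gm
        by (subst integral_completion) auto
      also have "\<dots> = (LINT x|lebesgue. indicator {max a (-real n)..min b (real n)} x * f x)"
      proof (rule integral_cong_AE)
        show "(\<lambda>x. indicator {a..b} x * g x) \<in> borel_measurable lebesgue"
          using measurable_completion[OF gm] by (auto intro!: borel_measurable_times borel_measurable_indicator)
        show "(\<lambda>x. indicator {max a (-real n)..min b (real n)} x * f x) \<in> borel_measurable lebesgue"
          using locally_integrable_measurable[OF f] by (auto intro!: borel_measurable_times borel_measurable_indicator)
        show "AE x in lebesgue. indicator {a..b} x * g x = indicator {max a (-real n)..min b (real n)} x * f x"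
          using g(2) by eventually_elim (auto simp: indicator_def split: if_splits)
      qed
      also have "\<dots> = 0" by (rule zero)
      finally show "(LINT x:{a..b}|lborel. g x) = 0" .
    qed
    from AE_completion[OF this] g(2) show ?thesis by eventually_elim simp
  qed
  then have "AE x in lebesgue. \<forall>n. indicator {-real n..real n} x * f x = 0"
    unfolding AE_all_countable by blast
  then show ?thesis
  proof eventually_elim
    case (elim x)
    obtain N where "\<bar>x\<bar> \<le> real N" using real_arch_simple by blast
    then show ?case using elim[rule_format, of N] by (auto simp: indicator_def)
  qed
qed

section \<open>Weak derivatives up to null sets\<close>

lemma has_weak_deriv_unique:
  assumes "has_weak_deriv u v" "has_weak_deriv u w"
  shows "AE x in lebesgue. v x = w x"
proof -
  have li: "locally_integrable v" "locally_integrable w"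
    using assms by (auto simp: has_weak_deriv_def)
  have "AE x in lebesgue. 1 * v x + (-1) * w x = 0"
  proof (rule AE_zero_if_test_integrals_zero)
    show "locally_integrable (\<lambda>x. 1 * v x + (-1) * w x)"
      using li by (rule locally_integrable_lincomb)
    fix \<eta> assume \<eta>: "test_function \<eta>"
    have "(LINT x|lebesgue. (1 * v x + (-1) * w x) * \<eta> x) = (LINT x|lebesgue. v x * \<eta> x - w x * \<eta> x)"
      by (simp add: algebra_simps)
    also have "\<dots> = (LINT x|lebesgue. v x * \<eta> x) - (LINT x|lebesgue. w x * \<eta> x)"
      by (intro Bochner_Integration.integral_diff integrable_times_test_function li \<eta>)
    also have "\<dots> = 0" using assms \<eta> by (simp add: has_weak_deriv_def)
    finally show "(LINT x|lebesgue. (1 * v x + (-1) * w x) * \<eta> x) = 0" .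
  qed
  then show ?thesis by eventually_elim simp
qed

text \<open>Makes it possible to pass between the representative picked by \<open>weak_deriv\<close>
  and a continuous one.\<close>

lemma has_weak_deriv_cong_AE:
  assumes "has_weak_deriv u v" "AE x in lebesgue. u x = u' x" "AE x in lebesgue. v x = v' x"
  shows "has_weak_deriv u' v'"
proof -
  have li: "locally_integrable u" "locally_integrable v"
    using assms by (auto simp: has_weak_deriv_def)
  have li': "locally_integrable u'" "locally_integrable v'"
    using li assms(2,3) locally_integrable_cong_AE by blast+
  have cong: "(LINT x|lebesgue. f x * \<eta> x) = (LINT x|lebesgue. g x * \<eta> x)"
    if "locally_integrable f" "locally_integrable g" "AE x in lebesgue. f x = g x" "test_function \<eta>" for f g \<eta>
    using integrable_times_test_function[OF that(1,4)] integrable_times_test_function[OF that(2,4)] that(3)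
    by (intro integral_cong_AE) (auto elim!: eventually_mono)
  show ?thesis unfolding has_weak_deriv_def
  proof (intro conjI allI impI li')
    fix \<eta> assume \<eta>: "test_function \<eta>"
    have "(LINT x|lebesgue. u x * deriv \<eta> x) = - (LINT x|lebesgue. v x * \<eta> x)"
      using assms(1) \<eta> by (simp add: has_weak_deriv_def)
    then show "(LINT x|lebesgue. u' x * deriv \<eta> x) = - (LINT x|lebesgue. v' x * \<eta> x)"
      using cong[OF li(1) li'(1) assms(2) test_function_deriv[OF \<eta>]] cong[OF li(2) li'(2) assms(3) \<eta>]
      by simp
  qed
qed

section \<open>Primitives of locally integrable functions\<close>

text \<open>Fubini on the half plane \<open>t \<le> x\<close>. With \<open>e\<close> the derivative
  of a test function this is integration by parts for a primitive that need not be differentiable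
  everywhere.\<close>

lemma integral_primitive_times:
  fixes f e :: "real \<Rightarrow> real"
  assumes f: "integrable lborel f" and e: "integrable lborel e"
  shows "(LINT x|lborel. (LINT t|lborel. indicator {..x} t * f t) * e x) =
    (LINT t|lborel. f t * (LINT x|lborel. indicator {t..} x * e x))"
proof -
  have [measurable]: "f \<in> borel_measurable borel" "e \<in> borel_measurable borel"
    using f e by auto
  have "integrable (lborel \<Otimes>\<^sub>M lborel) (\<lambda>(t, x). f t * e x)"
  proof (rule lborel_pair.Fubini_integrable)
    show "integrable lborel (\<lambda>t. LINT x|lborel. norm (case (t, x) of (t, x) \<Rightarrow> f t * e x))"
      using f by (simp add: abs_mult)
    show "AE t in lborel. integrable lborel (\<lambda>x. case (t, x) of (t, x) \<Rightarrow> f t * e x)"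
      using e by simp
  qed measurable
  then have "integrable (lborel \<Otimes>\<^sub>M lborel) (\<lambda>(t, x). of_bool (t \<le> x) * (f t * e x))"
    by (rule Bochner_Integration.integrable_bound) (auto simp: split_beta)
  from lborel_pair.Fubini_integral[OF this]
  have "(LINT x|lborel. LINT t|lborel. of_bool (t \<le> x) * (f t * e x)) =
    (LINT t|lborel. LINT x|lborel. of_bool (t \<le> x) * (f t * e x))" .
  moreover have "(LINT t|lborel. of_bool (t \<le> x) * (f t * e x)) = (LINT t|lborel. indicator {..x} t * f t * e x)" for x
    by (rule Bochner_Integration.integral_cong) (auto simp: indicator_def)
  moreover have "(LINT x|lborel. of_bool (t \<le> x) * (f t * e x)) = (LINT x|lborel. f t * (indicator {t..} x * e x))" for t
    by (rule Bochner_Integration.integral_cong) (auto simp: indicator_def)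
  ultimately show ?thesis by simp
qed

lemma test_function_deriv_integral:
  assumes "test_function \<eta>"
  shows "integrable lborel (deriv \<eta>)" "(LINT x|lborel. indicator {t..} x * deriv \<eta> x) = - \<eta> t"
    "(LINT x|lborel. deriv \<eta> x) = 0"
proof -
  obtain R where R: "R > 0" "\<And>x. \<bar>x\<bar> \<ge> R \<Longrightarrow> \<eta> x = 0" "\<And>x. \<bar>x\<bar> \<ge> R \<Longrightarrow> deriv \<eta> x = 0"
    using test_function_support[OF assms] by metis
  have sm: "smooth \<eta>" using assms by (simp add: test_function_def)
  have *: "set_integrable lborel {s..r} (deriv \<eta>)" "(LINT x:{s..r}|lborel. deriv \<eta> x) = \<eta> r - \<eta> s"
    if "s \<le> r" for s r
  proof -
    show int: "set_integrable lborel {s..r} (deriv \<eta>)"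
      unfolding set_integrable_def
      by (intro borel_integrable_compact smooth_continuous_on smooth_deriv sm) auto
    have "(deriv \<eta> has_integral \<eta> r - \<eta> s) {s..r}"
      by (intro fundamental_theorem_of_calculus that)
        (use smooth_DERIV[OF sm] in \<open>auto simp: has_real_derivative_iff_has_vector_derivative intro: has_vector_derivative_at_within\<close>)
    then show "(LINT x:{s..r}|lborel. deriv \<eta> x) = \<eta> r - \<eta> s"
      using set_borel_integral_eq_integral(2)[OF int] by (simp add: integral_unique)
  qed
  have ind: "indicator {-R..R} x * deriv \<eta> x = deriv \<eta> x" for x
    using R(3)[of x] by (cases "x \<in> {-R..R}") auto
  show "integrable lborel (deriv \<eta>)"
    using *(1)[of "-R" R] R(1) by (simp add: set_integrable_def ind)
  show "(LINT x|lborel. deriv \<eta> x) = 0"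
    using *(2)[of "-R" R] R by (simp add: set_lebesgue_integral_def ind)
  have "(LINT x|lborel. indicator {t..} x * deriv \<eta> x) = (LINT x:{t..max R t}|lborel. deriv \<eta> x)"
    unfolding set_lebesgue_integral_def
    by (rule Bochner_Integration.integral_cong) (auto simp: indicator_def R(3))
  also have "\<dots> = - \<eta> t" using *(2)[of t "max R t"] R by (cases "t \<le> R") auto
  finally show "(LINT x|lborel. indicator {t..} x * deriv \<eta> x) = - \<eta> t" .
qed

lemma primitive_continuous:
  assumes w: "locally_integrable w" and V: "\<And>x y. x \<le> y \<Longrightarrow> V y - V x = integral {x..y} w"
  shows "continuous_on UNIV V"
proof -
  have "isCont V x" for x
  proof -
    have "w integrable_on {x - 1..x + 1}"
      using w by (simp add: locally_integrable_def set_lebesgue_integral_eq_integral(1))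
    from indefinite_integral_continuous_1[OF this]
    have "continuous_on {x - 1..x + 1} (\<lambda>y. V (x - 1) + integral {x - 1..y} w)"
      by (intro continuous_intros)
    moreover have "V (x - 1) + integral {x - 1..y} w = V y" if "y \<in> {x - 1..x + 1}" for y
      using V[of "x - 1" y] that by (simp flip: V)
    ultimately have "continuous_on {x - 1..x + 1} V"
      using continuous_on_cong[OF refl, of "{x - 1..x + 1}" "\<lambda>y. V (x - 1) + integral {x - 1..y} w" V] by blast
    then show ?thesis
      by (rule continuous_on_interior) simp
  qed
  then show ?thesis by (simp add: continuous_at_imp_continuous_on)
qed

lemma primitive_exists:
  assumes w: "locally_integrable w"
  obtains V where "\<And>x y. x \<le> y \<Longrightarrow> V y - V x = integral {x..y} w"
proof
  \<comment> \<open>The signed integral from 0 to \<open>x\<close>: for \<open>x \<noteq> 0\<close>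
    one of the two intervals is empty and contributes 0.\<close>
  let ?V = "\<lambda>x. integral {0..x} w - integral {x..0} w"
  have w': "w integrable_on {a..b}" for a b
    using w by (simp add: locally_integrable_def set_lebesgue_integral_eq_integral(1))
  fix x y :: real assume xy: "x \<le> y"
  consider "0 \<le> x" | "x \<le> 0" "0 \<le> y" | "y \<le> 0" by linarith
  then show "?V y - ?V x = integral {x..y} w"
  proof cases
    case 1
    then show ?thesis using Henstock_Kurzweil_Integration.integral_combine[OF 1 xy w'] xy
      by (cases "x = 0"; cases "y = 0") auto
  next
    case 2
    then show ?thesis using Henstock_Kurzweil_Integration.integral_combine[OF 2 w']
      by (cases "x = 0"; cases "y = 0") auto
  next
    case 3
    then show ?thesis using Henstock_Kurzweil_Integration.integral_combine[OF xy 3 w'] xy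
      by (cases "x = 0"; cases "y = 0") auto
  qed
qed

text \<open>On the support of the test function, \<open>V\<close> differs by a constant from the
  primitive of the truncation \<open>f\<close> of \<open>w\<close> to \<open>{-R..R}\<close>, to
  which integration by parts via Fubini applies.\<close>

lemma primitive_has_weak_deriv:
  assumes w: "locally_integrable w" and V: "\<And>x y. x \<le> y \<Longrightarrow> V y - V x = integral {x..y} w"
  shows "has_weak_deriv V w"
  unfolding has_weak_deriv_def
proof (intro conjI allI impI)
  show "locally_integrable w" by fact
  have contV: "continuous_on UNIV V" using primitive_continuous[OF assms] .
  then show "locally_integrable V" by (rule locally_integrable_continuous)
  fix \<eta> assume \<eta>: "test_function \<eta>"
  obtain R where R: "R > 0" "\<And>x. \<bar>x\<bar> \<ge> R \<Longrightarrow> \<eta> x = 0" "\<And>x. \<bar>x\<bar> \<ge> R \<Longrightarrow> deriv \<eta> x = 0"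
    using test_function_support[OF \<eta>] by metis
  have sm: "smooth \<eta>" using \<eta> by (simp add: test_function_def)
  have meas: "\<eta> \<in> borel_measurable borel" "deriv \<eta> \<in> borel_measurable borel"
    "V \<in> borel_measurable borel"
    by (auto intro!: borel_measurable_continuous_onI contV smooth_continuous_on smooth_deriv sm)
  obtain f where f: "integrable lborel f" and fw: "AE x in lebesgue. indicator {-R..R} x * w x = f x"
    using lebesgue_integrable_borel_version[OF locally_integrable_integrable[OF w]] by blast
  have fm[measurable]: "f \<in> borel_measurable borel" using f by simp
  have prim: "(LINT t|lborel. indicator {..x} t * f t) = V x - V (-R)" if x: "x \<in> {-R..R}" for x
  proof -
    have "(LINT t|lborel. indicator {..x} t * f t) = (LINT t|lebesgue. indicator {..x} t * f t)"
      by (rule integral_completion[symmetric]) measurable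
    also have "\<dots> = (LINT t|lebesgue. indicator {-R..x} t * w t)"
    proof (rule integral_cong_AE)
      show "(\<lambda>t. indicator {..x} t * f t) \<in> borel_measurable lebesgue"
        by (rule measurable_completion) measurable
      show "(\<lambda>t. indicator {-R..x} t * w t) \<in> borel_measurable lebesgue"
        using locally_integrable_integrable[OF w] by (rule borel_measurable_integrable)
      show "AE t in lebesgue. indicator {..x} t * f t = indicator {-R..x} t * w t"
        using fw by eventually_elim (use x in \<open>auto simp: indicator_def split: if_splits\<close>)
    qed
    also have "\<dots> = (LINT t:{-R..x}|lebesgue. w t)" by (simp add: set_lebesgue_integral_def)
    also have "\<dots> = integral {-R..x} w"
      using w by (intro set_lebesgue_integral_eq_integral) (simp add: locally_integrable_def)
    finally show ?thesis using V[of "-R" x] x by simp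
  qed
  note d = test_function_deriv_integral[OF \<eta>]
  have "integrable lborel (\<lambda>x. V x * deriv \<eta> x)"
    using integrable_times_test_function[OF locally_integrable_continuous[OF contV] test_function_deriv[OF \<eta>]]
      integrable_completion[of "\<lambda>x. V x * deriv \<eta> x" lborel] meas by simp
  \<comment> \<open>Subtracting the constant \<open>V (-R)\<close> changes nothing, since
    \<open>deriv \<eta>\<close> has integral 0.\<close>
  then have "(LINT x|lborel. V x * deriv \<eta> x) = (LINT x|lborel. V x * deriv \<eta> x - V (-R) * deriv \<eta> x)"
    using d(1,3) by simp
  also have "\<dots> = (LINT x|lborel. (LINT t|lborel. indicator {..x} t * f t) * deriv \<eta> x)"
  proof (rule Bochner_Integration.integral_cong)
    fix x
    show "V x * deriv \<eta> x - V (-R) * deriv \<eta> x = (LINT t|lborel. indicator {..x} t * f t) * deriv \<eta> x"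
      using prim[of x] R(3)[of x] by (cases "x \<in> {-R..R}") (auto simp: left_diff_distrib)
  qed simp
  also have "\<dots> = - (LINT t|lborel. f t * \<eta> t)"
    using integral_primitive_times[OF f d(1)] by (simp add: d(2))
  also have "(LINT t|lborel. f t * \<eta> t) = (LINT t|lebesgue. f t * \<eta> t)"
    using meas by (intro integral_completion[symmetric]) measurable
  also have "\<dots> = (LINT t|lebesgue. w t * \<eta> t)"
  proof (rule integral_cong_AE)
    show "(\<lambda>t. f t * \<eta> t) \<in> borel_measurable lebesgue"
      using meas by (intro measurable_completion) measurable
    show "(\<lambda>t. w t * \<eta> t) \<in> borel_measurable lebesgue"
      using integrable_times_test_function[OF w \<eta>] by (rule borel_measurable_integrable)
    show "AE t in lebesgue. f t * \<eta> t = w t * \<eta> t"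
      using fw
    proof eventually_elim
      case (elim t)
      show ?case
      proof (cases "\<bar>t\<bar> \<ge> R")
        case False
        then have "t \<in> {-R..R}" by auto
        then show ?thesis using elim by simp
      qed (simp add: R(2))
    qed
  qed
  finally show "(LINT x|lebesgue. V x * deriv \<eta> x) = - (LINT x|lebesgue. w x * \<eta> x)"
    using meas by (subst integral_completion) auto
qed

lemma primitive_DERIV:
  assumes cont: "continuous_on UNIV \<theta>" and F: "\<And>x y. x \<le> y \<Longrightarrow> F y - F x = integral {x..y} \<theta>"
  shows "(F has_real_derivative \<theta> x) (at x)"
proof -
  have "((\<lambda>u. integral {x - 1..u} \<theta>) has_real_derivative \<theta> x) (at x within {x - 1..x + 1})"
    by (rule integral_has_real_derivative) (auto intro: continuous_on_subset[OF cont])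
  then have "((\<lambda>u. F (x - 1) + integral {x - 1..u} \<theta>) has_real_derivative 0 + \<theta> x) (at x within {x - 1..x + 1})"
    by (intro DERIV_add DERIV_const)
  then have "((\<lambda>u. F (x - 1) + integral {x - 1..u} \<theta>) has_real_derivative \<theta> x) (at x)"
    by (simp add: at_within_Icc_at)
  then show ?thesis
    by (rule has_field_derivative_transform_within_open[where S="{x - 1<..<x + 1}"])
      (auto simp flip: F)
qed

section \<open>Functions with vanishing weak derivative\<close>

text \<open>The antiderivative normalised to vanish left of the support equals the full integral of
  \<open>\<theta>\<close> to the right of it, so mean zero is exactly what makes it compactly
  supported.\<close>

lemma test_function_primitive:
  assumes \<theta>: "test_function \<theta>" and 0: "(LINT x|lebesgue. \<theta> x) = 0"
  obtains \<eta> where "test_function \<eta>" "deriv \<eta> = \<theta>"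
proof -
  have sm: "smooth \<theta>" and cont: "continuous_on UNIV \<theta>"
    using \<theta> by (auto simp: test_function_def smooth_continuous_on)
  obtain R where R: "R > 0" "\<And>x. \<bar>x\<bar> \<ge> R \<Longrightarrow> \<theta> x = 0"
    using test_function_support[OF \<theta>] by metis
  obtain F where F: "\<And>x y. x \<le> y \<Longrightarrow> F y - F x = integral {x..y} \<theta>"
    using primitive_exists[OF locally_integrable_continuous[OF cont]] by blast
  note DF = primitive_DERIV[OF cont F]
  define \<eta> where "\<eta> x = F x - F (-R)" for x
  have D: "(\<eta> has_real_derivative \<theta> x) (at x)" for x
    unfolding \<eta>_def by (auto intro!: derivative_eq_intros DF)
  then have dd: "deriv \<eta> = \<theta>" using DERIV_imp_deriv by blast
  have "\<eta> differentiable_on UNIV" using D by (auto simp: differentiable_on_def real_differentiable_def)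
  then have "smooth \<eta>" using smooth_iff[of \<eta>] dd sm by simp
  moreover have "\<eta> x = 0" if x: "x \<notin> {-R..R}" for x
  proof -
    have z: "integral {a..b} \<theta> = 0" if "b \<le> -R \<or> R \<le> a" for a b
      using integral_cong[of "{a..b}" \<theta> "\<lambda>x. 0"] that R by force
    have "indicator {-R..R} x * \<theta> x = \<theta> x" for x
      using R(2)[of x] by (cases "x \<in> {-R..R}") auto
    then have "(LINT x|lebesgue. \<theta> x) = (LINT x:{-R..R}|lebesgue. \<theta> x)"
      unfolding set_lebesgue_integral_def real_scaleR_def by presburger
    also have "\<dots> = integral {-R..R} \<theta>"
      by (intro set_lebesgue_integral_eq_integral absolutely_integrable_continuous_real continuous_on_subset[OF cont]) auto
    finally have "F R = F (-R)" using F[of "-R" R] R(1) 0 by simp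
    then show ?thesis
      using F[of x "-R"] F[of R x] z[of "-R" x] z[of x R] x by (auto simp: \<eta>_def z)
  qed
  ultimately show ?thesis using that[OF _ dd] test_functionI by blast
qed

text \<open>The du Bois-Reymond argument: any test function minus a suitable multiple of one fixed
  bump has mean zero, hence is the derivative of a test function and is annihilated by
  \<open>f\<close>.\<close>

lemma AE_const_if_weak_deriv_zero:
  assumes "has_weak_deriv f (\<lambda>x. 0)"
  obtains C where "AE x in lebesgue. f x = C"
proof -
  have f: "locally_integrable f" and 0: "\<And>\<eta>. test_function \<eta> \<Longrightarrow> (LINT x|lebesgue. f x * deriv \<eta> x) = 0"
    using assms by (auto simp: has_weak_deriv_def)
  let ?\<beta> = "bump 1 0 1"
  have \<beta>: "test_function ?\<beta>" by (simp add: test_function_bump)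
  have one: "locally_integrable (\<lambda>x. 1)" by (simp add: locally_integrable_continuous)
  have int: "integrable lebesgue \<psi>" if "test_function \<psi>" for \<psi>
    using integrable_times_test_function[OF one that] by simp
  define b where "b = (LINT x|lebesgue. ?\<beta> x)"
  have "b \<noteq> 0"
  proof
    assume "b = 0"
    then have "AE x in lebesgue. ?\<beta> x = 0"
      using integral_nonneg_eq_0_iff_AE[OF int[OF \<beta>]] bump_nonneg by (simp add: b_def)
    \<comment> \<open>A closed set containing almost every point is the whole line, yet this one
      misses \<open>1/2\<close>.\<close>
    then have "AE x in lebesgue. x \<in> - {0<..<1::real}"
    proof eventually_elim
      case (elim x)
      then show ?case using bump_pos[of 1 0 x 1] by force
    qed
    then have "1/2 \<in> - {0<..<1::real}"
      by (rule mem_closed_if_AE_lebesgue[rotated]) (simp add: closed_Compl)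
    then show False by simp
  qed
  \<comment> \<open>The mean of \<open>f\<close> weighted by the bump, the only candidate for the
    constant.\<close>
  define C where "C = (LINT x|lebesgue. f x * ?\<beta> x) / b"
  have "AE x in lebesgue. 1 * f x + (- C) * 1 = 0"
  proof (rule AE_zero_if_test_integrals_zero)
    show "locally_integrable (\<lambda>x. 1 * f x + (- C) * 1)"
      using f one by (rule locally_integrable_lincomb)
    fix \<psi> assume \<psi>: "test_function \<psi>"
    define k where "k = (LINT x|lebesgue. \<psi> x) / b"
    have "test_function (\<lambda>x. 1 * \<psi> x + (- k) * ?\<beta> x)"
      using \<psi> \<beta> by (rule test_function_lincomb)
    moreover have "(LINT x|lebesgue. 1 * \<psi> x + (- k) * ?\<beta> x) = 0"
      using int[OF \<psi>] int[OF \<beta>] \<open>b \<noteq> 0\<close> by (simp add: k_def b_def[symmetric])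
    ultimately obtain \<eta> where \<eta>: "test_function \<eta>" "deriv \<eta> = (\<lambda>x. 1 * \<psi> x + (- k) * ?\<beta> x)"
      using test_function_primitive by metis
    have "(LINT x|lebesgue. f x * deriv \<eta> x) = (LINT x|lebesgue. f x * \<psi> x - k * (f x * ?\<beta> x))"
      by (simp add: \<eta>(2) algebra_simps)
    also have "\<dots> = (LINT x|lebesgue. f x * \<psi> x) - k * (LINT x|lebesgue. f x * ?\<beta> x)"
      using integrable_times_test_function[OF f] \<psi> \<beta> by simp
    finally have "(LINT x|lebesgue. f x * \<psi> x) = C * (LINT x|lebesgue. \<psi> x)"
      using 0[OF \<eta>(1)] by (simp add: C_def k_def)
    moreover have "(LINT x|lebesgue. (1 * f x + (- C) * 1) * \<psi> x) = (LINT x|lebesgue. f x * \<psi> x - C * \<psi> x)"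
      by (simp add: algebra_simps)
    ultimately show "(LINT x|lebesgue. (1 * f x + (- C) * 1) * \<psi> x) = 0"
      using integrable_times_test_function[OF f \<psi>] int[OF \<psi>] by simp
  qed
  then have "AE x in lebesgue. f x = C" by eventually_elim simp
  then show ?thesis using that by blast
qed

text \<open>The difference of \<open>u\<close> and any primitive of \<open>v\<close> has weak
  derivative zero, so it is a constant that can be absorbed into the primitive.\<close>

lemma has_weak_deriv_imp_AE_primitive:
  assumes uv: "has_weak_deriv u v"
  obtains U where "\<And>x y. x \<le> y \<Longrightarrow> U y - U x = integral {x..y} v" "AE x in lebesgue. u x = U x"
proof -
  have v: "locally_integrable v" and u: "locally_integrable u" using uv by (auto simp: has_weak_deriv_def)
  obtain V where V: "\<And>x y. x \<le> y \<Longrightarrow> V y - V x = integral {x..y} v"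
    using primitive_exists[OF v] by blast
  have Vv: "has_weak_deriv V v" using primitive_has_weak_deriv[OF v V] .
  then have V': "locally_integrable V" by (simp add: has_weak_deriv_def)
  have "has_weak_deriv (\<lambda>x. 1 * u x + (-1) * V x) (\<lambda>x. 0)"
    unfolding has_weak_deriv_def
  proof (intro conjI allI impI)
    show "locally_integrable (\<lambda>x. 1 * u x + (-1) * V x)" using u V' by (rule locally_integrable_lincomb)
    show "locally_integrable (\<lambda>x. 0)" by (simp add: locally_integrable_continuous)
    fix \<eta> assume \<eta>: "test_function \<eta>"
    have "(LINT x|lebesgue. (1 * u x + (-1) * V x) * deriv \<eta> x) = (LINT x|lebesgue. u x * deriv \<eta> x - V x * deriv \<eta> x)"
      by (simp add: algebra_simps)
    also have "\<dots> = (LINT x|lebesgue. u x * deriv \<eta> x) - (LINT x|lebesgue. V x * deriv \<eta> x)"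
      by (intro Bochner_Integration.integral_diff integrable_times_test_function u V' test_function_deriv \<eta>)
    also have "\<dots> = 0" using uv Vv \<eta> by (simp add: has_weak_deriv_def)
    finally show "(LINT x|lebesgue. (1 * u x + (-1) * V x) * deriv \<eta> x) = - (LINT x|lebesgue. 0 * \<eta> x)" by simp
  qed
  then obtain C where "AE x in lebesgue. 1 * u x + (-1) * V x = C"
    using AE_const_if_weak_deriv_zero by blast
  then have "AE x in lebesgue. u x = V x + C" by eventually_elim simp
  with V show ?thesis by (intro that[of "\<lambda>x. V x + C"]) auto
qed

section \<open>Classical representatives and one-sided slope bounds\<close>

lemma FTC_integral:
  assumes "\<And>x. (F has_real_derivative f x) (at x)" "x \<le> y"
  shows "F y - F x = integral {x..y} f"
proof -
  have "(f has_integral F y - F x) {x..y}"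
    by (intro fundamental_theorem_of_calculus assms(2))
      (use assms(1) in \<open>auto simp: has_real_derivative_iff_has_vector_derivative intro: has_vector_derivative_at_within\<close>)
  then show ?thesis by (simp add: integral_unique)
qed

lemma antiderivative_exists:
  assumes "continuous_on UNIV f"
  obtains F where "\<And>x::real. (F has_real_derivative f x) (at x)"
  using primitive_exists[OF locally_integrable_continuous[OF assms]] primitive_DERIV[OF assms] by metis

lemma C1_has_weak_deriv:
  assumes "\<And>x. (u has_real_derivative v x) (at x)" "continuous_on UNIV v"
  shows "has_weak_deriv u v"
  using primitive_has_weak_deriv[OF locally_integrable_continuous[OF assms(2)]]
    FTC_integral[OF assms(1)] by blast

text \<open>\<open>op_L\<close> applies the arbitrary choice \<open>weak_deriv\<close> twice.
  Replacing the inner choice by \<open>v\<close> almost everywhere does not affect weak derivatives,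
  and uniqueness settles the outer one.\<close>

lemma AE_op_L_eq:
  assumes "has_weak_deriv u v" "has_weak_deriv v w"
  shows "AE x in lebesgue. op_L (\<lambda>_. 1) c u x = w x + c x * u x"
proof -
  have wd: "has_weak_deriv u (weak_deriv u)"
    unfolding weak_deriv_def by (rule someI[of "has_weak_deriv u", OF assms(1)])
  have "AE x in lebesgue. v x = weak_deriv u x"
    using assms(1) wd by (rule has_weak_deriv_unique)
  then have "has_weak_deriv (weak_deriv u) w"
    using has_weak_deriv_cong_AE[OF assms(2)] by blast
  moreover from this have "has_weak_deriv (weak_deriv u) (weak_deriv (weak_deriv u))"
    unfolding weak_deriv_def[of "weak_deriv u"] by (rule someI[of "has_weak_deriv (weak_deriv u)"])
  ultimately have "AE x in lebesgue. weak_deriv (weak_deriv u) x = w x"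
    using has_weak_deriv_unique by blast
  then show ?thesis by eventually_elim (simp add: op_L_def)
qed

lemma C2_in_W21_loc:
  assumes u: "\<And>x. (u has_real_derivative v x) (at x)" and v: "\<And>x. (v has_real_derivative w x) (at x)"
    and w: "continuous_on UNIV w"
  shows "u \<in> W21_loc" "AE x in lebesgue. op_L (\<lambda>_. 1) c u x = w x + c x * u x"
proof -
  have "continuous_on UNIV v" "continuous_on UNIV u"
    using u v by (auto intro!: continuous_at_imp_continuous_on DERIV_isCont)
  then have "continuous_on UNIV u" "has_weak_deriv u v" "has_weak_deriv v w"
    using C1_has_weak_deriv u v w by blast+
  then show "u \<in> W21_loc" "AE x in lebesgue. op_L (\<lambda>_. 1) c u x = w x + c x * u x"
    by (auto simp: W21_loc_def AE_op_L_eq)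
qed

text \<open>The weak derivative of \<open>u\<close> has a continuous representative, being a
  primitive of \<open>w\<close>; \<open>u\<close> is a primitive of that one almost everywhere, and
  everywhere since both sides are continuous.\<close>

lemma W21_loc_C1_representation:
  assumes "u \<in> W21_loc"
  obtains v w where "\<And>x. (u has_real_derivative v x) (at x)" "continuous_on UNIV v"
    "\<And>x y. x \<le> y \<Longrightarrow> v y - v x = integral {x..y} w" "locally_integrable w"
    "AE x in lebesgue. op_L (\<lambda>_. 1) c u x = w x + c x * u x"
proof -
  obtain v0 w where contu: "continuous_on UNIV u" and uv0: "has_weak_deriv u v0" and v0w: "has_weak_deriv v0 w"
    using assms by (auto simp: W21_loc_def)
  have w: "locally_integrable w" using v0w by (simp add: has_weak_deriv_def)
  obtain v where v: "\<And>x y. x \<le> y \<Longrightarrow> v y - v x = integral {x..y} w" "AE x in lebesgue. v0 x = v x"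
    using has_weak_deriv_imp_AE_primitive[OF v0w] by blast
  have contv: "continuous_on UNIV v" using primitive_continuous[OF w v(1)] .
  have uv: "has_weak_deriv u v" using has_weak_deriv_cong_AE[OF uv0 _ v(2)] by simp
  obtain U where U: "\<And>x y. x \<le> y \<Longrightarrow> U y - U x = integral {x..y} v" "AE x in lebesgue. u x = U x"
    using has_weak_deriv_imp_AE_primitive[OF uv] by blast
  note DU = primitive_DERIV[OF contv U(1)]
  then have contU: "continuous_on UNIV U" by (auto intro!: continuous_at_imp_continuous_on DERIV_isCont)
  have "u x = U x" for x
  proof -
    have "closed {x. u x = U x}" using contu contU by (rule closed_Collect_eq)
    then have "x \<in> {x. u x = U x}" using U(2) by (intro mem_closed_if_AE_lebesgue) auto
    then show ?thesis by simp
  qed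
  then have "u = U" by blast
  then show ?thesis
    using that[OF _ contv v(1) w AE_op_L_eq[OF uv primitive_has_weak_deriv[OF w v(1)]]] DU by blast
qed

text \<open>The derivative \<open>\<psi>\<close> of a weak supersolution need not be differentiable, but
  it is dominated to the right of each point by a translate of the \<open>C\<^sup>1\<close> function \<open>D\<close>;
  this replaces the pointwise inequality for the second derivative.\<close>

lemma supersolution_derivative:
  assumes \<phi>: "\<phi> \<in> W21_loc" and c: "continuous_on UNIV c"
    and super: "AE x in lebesgue. op_L (\<lambda>_. 1) c \<phi> x \<le> - \<mu> * \<phi> x"
  obtains \<psi> D where "\<And>x. (\<phi> has_real_derivative \<psi> x) (at x)" "continuous_on UNIV \<psi>"
    "\<And>x. (D has_real_derivative - (c x + \<mu>) * \<phi> x) (at x)"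
    "\<And>x y. x \<le> y \<Longrightarrow> \<psi> y \<le> \<psi> x + (D y - D x)"
proof -
  obtain \<psi> w where \<psi>: "\<And>x. (\<phi> has_real_derivative \<psi> x) (at x)" "continuous_on UNIV \<psi>"
    and w: "\<And>x y. x \<le> y \<Longrightarrow> \<psi> y - \<psi> x = integral {x..y} w" "locally_integrable w"
    and L: "AE x in lebesgue. op_L (\<lambda>_. 1) c \<phi> x = w x + c x * \<phi> x"
    by (rule W21_loc_C1_representation[OF \<phi>, where c=c]) (rule that; assumption)
  define g where "g x = - (c x + \<mu>) * \<phi> x" for x
  have "continuous_on UNIV \<phi>" using \<phi> by (simp add: W21_loc_def)
  then have contg: "continuous_on UNIV g" unfolding g_def by (intro continuous_intros c)
  then have g: "locally_integrable g" by (rule locally_integrable_continuous)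
  obtain D where D: "\<And>x y. x \<le> y \<Longrightarrow> D y - D x = integral {x..y} g"
    using primitive_exists[OF g] by blast
  have wg: "AE x in lebesgue. w x \<le> g x"
    using super L by eventually_elim (simp add: g_def algebra_simps)
  have maj: "\<psi> y \<le> \<psi> x + (D y - D x)" if "x \<le> y" for x y
  proof -
    have "(LINT t:{x..y}|lebesgue. w t) \<le> (LINT t:{x..y}|lebesgue. g t)"
      unfolding set_lebesgue_integral_def
      by (rule integral_mono_AE)
        (use locally_integrable_integrable[OF g] locally_integrable_integrable[OF w(2)] wg in
          \<open>auto elim!: eventually_mono intro: mult_left_mono\<close>)
    moreover have "(LINT t:{x..y}|lebesgue. w t) = integral {x..y} w" "(LINT t:{x..y}|lebesgue. g t) = integral {x..y} g"
      using w(2) g by (auto simp: locally_integrable_def set_lebesgue_integral_eq_integral)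
    ultimately show ?thesis using w(1)[OF that] D[OF that] by simp
  qed
  have "(D has_real_derivative - (c x + \<mu>) * \<phi> x) (at x)" for x
    using primitive_DERIV[OF contg D] unfolding g_def .
  then show ?thesis using that[of \<psi> D] \<psi> maj by blast
qed

text \<open>A mean value inequality without differentiability: the touching majorant bounds the
  upper right Dini derivative of \<open>f\<close> by \<open>d\<close>.\<close>

lemma right_majorant_slope_bound:
  fixes f :: "real \<Rightarrow> real"
  assumes f: "continuous_on UNIV f"
    and maj: "\<And>x. \<exists>e e'. e x = f x \<and> (\<forall>y\<ge>x. f y \<le> e y) \<and> (e has_real_derivative e') (at x) \<and> e' \<le> d"
    and "a \<le> b"
  shows "f b \<le> f a + d * (b - a)"
proof (rule field_le_epsilon)
  fix \<epsilon>0 :: real assume "\<epsilon>0 > 0"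
  \<comment> \<open>The summand 1 covers the case \<open>a = b\<close>.\<close>
  define \<epsilon> where "\<epsilon> = \<epsilon>0 / (b - a + 1)"
  have \<epsilon>: "\<epsilon> > 0" "\<epsilon> * (b - a) \<le> \<epsilon>0"
    using \<open>\<epsilon>0 > 0\<close> \<open>a \<le> b\<close> by (auto simp: \<epsilon>_def field_simps)
  define S where "S = {x \<in> {a..b}. f x \<le> f a + (d + \<epsilon>) * (x - a)}"
  have "closed {x. f x \<le> f a + (d + \<epsilon>) * (x - a)}"
    by (intro closed_Collect_le continuous_intros f)
  then have "compact ({a..b} \<inter> {x. f x \<le> f a + (d + \<epsilon>) * (x - a)})"
    by (intro compact_Int_closed) auto
  then have "compact S" by (simp add: S_def Int_def)
  moreover have "a \<in> S" using \<open>a \<le> b\<close> by (simp add: S_def)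
  ultimately obtain s where s: "s \<in> S" "\<And>t. t \<in> S \<Longrightarrow> t \<le> s"
    using compact_attains_sup[of S] by blast
  \<comment> \<open>At the last point \<open>s\<close> where the bound with slope
    \<open>d + \<epsilon>\<close> holds, the majorant has slope at most \<open>d\<close>, so the
    bound persists a little to the right of \<open>s\<close>.\<close>
  have "s = b"
  proof (rule ccontr)
    assume "s \<noteq> b"
    then have "s < b" using s(1) by (simp add: S_def)
    obtain e e' where e: "e s = f s" "\<And>y. y \<ge> s \<Longrightarrow> f y \<le> e y" "(e has_real_derivative e') (at s)" "e' \<le> d"
      using maj[of s] by blast
    have "((\<lambda>y. (d + \<epsilon>) * y - e y) has_real_derivative (d + \<epsilon>) - e') (at s)"
      by (auto intro!: derivative_eq_intros e(3))
    moreover have "(d + \<epsilon>) - e' > 0" using e(4) \<epsilon>(1) by simp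
    ultimately obtain \<delta> where \<delta>: "\<delta> > 0" "\<And>h. 0 < h \<Longrightarrow> h < \<delta> \<Longrightarrow>
        (d + \<epsilon>) * s - e s < (d + \<epsilon>) * (s + h) - e (s + h)"
      using DERIV_pos_inc_right[of "\<lambda>y. (d + \<epsilon>) * y - e y"] by blast
    define h where "h = min (\<delta> / 2) (b - s)"
    have h: "0 < h" "h < \<delta>" "s + h \<le> b" using \<delta>(1) \<open>s < b\<close> by (auto simp: h_def)
    have "f (s + h) \<le> e (s + h)" using e(2) h(1) by simp
    also have "\<dots> \<le> f s + (d + \<epsilon>) * h" using \<delta>(2)[OF h(1,2)] e(1) by (simp add: algebra_simps)
    also have "\<dots> \<le> f a + (d + \<epsilon>) * (s + h - a)" using s(1) by (simp add: S_def algebra_simps)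
    finally have "s + h \<in> S" using h s(1) by (simp add: S_def)
    then show False using s(2) h(1) by fastforce
  qed
  then have "f b \<le> f a + (d + \<epsilon>) * (b - a)" using s(1) by (simp add: S_def)
  then show "f b \<le> f a + d * (b - a) + \<epsilon>0" using \<epsilon>(2) by (simp add: algebra_simps)
qed

section \<open>Operators with a positive solution in exponential form\<close>

text \<open>\<open>p\<close> is the logarithmic derivative of the solution \<open>exp P\<close>, and
  \<open>c\<close> below is what the Riccati equation \<open>p' + p^2 + c = 0\<close> forces. The
  locale serves both the operator and, with the sign of \<open>P\<close> reversed, its
  limit.\<close>

locale riccati_potential =
  fixes P p p' :: "real \<Rightarrow> real"
  assumes DERIV_P: "\<And>x. (P has_real_derivative p x) (at x)"
    and DERIV_p: "\<And>x. (p has_real_derivative p' x) (at x)"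
    and continuous_p': "continuous_on UNIV p'"
begin

definition c :: "real \<Rightarrow> real" where
  "c x = - (p' x + (p x)\<^sup>2)"

lemma continuous_p: "continuous_on UNIV p"
  using DERIV_p by (auto intro!: continuous_at_imp_continuous_on DERIV_isCont)

lemma continuous_P: "continuous_on UNIV P"
  using DERIV_P by (auto intro!: continuous_at_imp_continuous_on DERIV_isCont)

lemma continuous_c: "continuous_on UNIV c"
  unfolding c_def by (intro continuous_intros continuous_p continuous_p')

text \<open>Reduction of order: the second solution of \<open>u'' + c u = 0\<close> is \<open>exp P \<cdot> \<integral> exp (- 2 P)\<close>.\<close>

lemma exp_mult_solution:
  assumes I: "\<And>x. (I has_real_derivative k * exp (- 2 * P x)) (at x)" and pos: "\<And>x. I x > 0"
  shows "(\<lambda>x. exp (P x) * I x) \<in> positive_solutions (\<lambda>_. 1) c"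
proof -
  define u where "u x = exp (P x) * I x" for x
  define v where "v x = p x * u x + k * exp (- P x)" for x
  have e: "exp (P x) * exp (- 2 * P x) = exp (- P x)" for x by (simp flip: exp_add)
  have u: "(u has_real_derivative v x) (at x)" for x
    using DERIV_mult[OF DERIV_chain2[OF DERIV_exp DERIV_P] I, of x]
    unfolding u_def v_def by (simp add: algebra_simps flip: e)
  have v: "(v has_real_derivative - c x * u x) (at x)" for x
    unfolding v_def[abs_def]
    by (auto intro!: derivative_eq_intros DERIV_p u DERIV_chain2[OF DERIV_exp] DERIV_P
        simp: c_def v_def algebra_simps power2_eq_square)
  have "continuous_on UNIV u"
    using u by (auto intro!: continuous_at_imp_continuous_on DERIV_isCont)
  then have w: "continuous_on UNIV (\<lambda>x. - c x * u x)"
    by (intro continuous_intros continuous_c)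
  have "AE x in lebesgue. op_L (\<lambda>_. 1) c u x = - c x * u x + c x * u x"
    by (rule C2_in_W21_loc(2)[OF u v w])
  then have "AE x in lebesgue. op_L (\<lambda>_. 1) c u x = 0" by eventually_elim simp
  then have "u \<in> positive_solutions (\<lambda>_. 1) c"
    using C2_in_W21_loc(1)[OF u v w] pos by (simp add: positive_solutions_def u_def)
  then show ?thesis by (simp add: u_def[abs_def])
qed

lemma exp_solution: "(\<lambda>x. exp (P x)) \<in> positive_solutions (\<lambda>_. 1) c"
  using exp_mult_solution[of "\<lambda>x. 1" 0] by simp

lemma positive_solutions_subset: "positive_solutions A b \<subseteq> positive_supersolutions A b"
  by (auto simp: positive_solutions_def positive_supersolutions_def elim: eventually_mono)

text \<open>The decay keeps an antiderivative of \<open>exp (- 2 P)\<close> bounded below, so a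
  constant makes it positive; as it is strictly increasing, the second solution is not proportional
  to \<open>exp P\<close>.\<close>

lemma subcritical_if_integrable:
  assumes decay: "\<And>x. exp (- 2 * P x) \<le> K / (1 + x\<^sup>2)"
  shows "subcritical (\<lambda>_. 1) c"
proof -
  have "continuous_on UNIV (\<lambda>x. exp (- 2 * P x))"
    by (intro continuous_intros continuous_P)
  then obtain I where I: "\<And>x. (I has_real_derivative exp (- 2 * P x)) (at x)"
    using antiderivative_exists by blast
  have "0 < exp (- 2 * P 0)" by simp
  also have "\<dots> \<le> K" using decay[of 0] by simp
  finally have K: "K > 0" .
  \<comment> \<open>\<open>I\<close> increases, so only the left half-line matters; there
    \<open>K * arctan\<close> grows at least as fast as \<open>I\<close>, and 2 is a bound for
    pi/2.\<close>
  have lower: "I x \<ge> I 0 - K * 2" for x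
  proof (cases "x \<ge> 0")
    case True
    have "I 0 \<le> I x"
      by (rule DERIV_nonneg_imp_nondecreasing[OF True]) (use I in force)
    then show ?thesis using K by simp
  next
    case False
    have "I 0 - K * arctan 0 \<le> I x - K * arctan x"
    proof (rule DERIV_nonpos_imp_nonincreasing[where f="\<lambda>x. I x - K * arctan x"])
      fix y :: real
      have "((\<lambda>x. I x - K * arctan x) has_real_derivative exp (- 2 * P y) - K * inverse (1 + y\<^sup>2)) (at y)"
        by (intro DERIV_diff I DERIV_cmult DERIV_arctan)
      moreover have "exp (- 2 * P y) - K * inverse (1 + y\<^sup>2) \<le> 0"
        using decay[of y] by (simp add: divide_inverse)
      ultimately show "\<exists>d. ((\<lambda>x. I x - K * arctan x) has_real_derivative d) (at y) \<and> d \<le> 0" by blast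
    qed (use False in simp)
    moreover have "arctan x \<ge> - 2" using arctan_lbound[of x] pi_less_4 by simp
    then have "K * arctan x \<ge> K * (- 2)" using K by (intro mult_left_mono) auto
    ultimately show ?thesis by simp
  qed
  define J where "J x = I x - I 0 + K * 2 + 1" for x
  have J: "(J has_real_derivative 1 * exp (- 2 * P x)) (at x)" for x
    unfolding J_def by (auto intro!: derivative_eq_intros I)
  have "J x > 0" for x using lower[of x] by (simp add: J_def)
  then have "(\<lambda>x. exp (P x) * J x) \<in> positive_solutions (\<lambda>_. 1) c"
    using J by (rule exp_mult_solution[rotated])
  then have mem: "(\<lambda>x. exp (P x) * J x) \<in> positive_supersolutions (\<lambda>_. 1) c"
    "(\<lambda>x. exp (P x)) \<in> positive_supersolutions (\<lambda>_. 1) c"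
    using exp_solution positive_solutions_subset by blast+
  have "\<not> critical (\<lambda>_. 1) c"
  proof
    assume "critical (\<lambda>_. 1) c"
    then obtain k where "\<And>x. exp (P x) * J x = k * exp (P x)"
      using mem by (force simp: critical_def)
    then have "J = (\<lambda>x. k)" by (auto simp: mult.commute)
    then have "(J has_real_derivative 0) (at 0)" by simp
    from DERIV_unique[OF J[of 0] this] show False by simp
  qed
  then show ?thesis using exp_solution by (auto simp: subcritical_def supercritical_def)
qed

text \<open>For a positive supersolution \<open>\<phi>\<close>, the Wronskian \<open>h\<close> of \<open>exp P\<close> and \<open>\<phi>\<close> is nonincreasing,
  and \<open>(\<phi> exp (- P))' = h exp (- 2 P)\<close> with \<open>exp (- 2 P) \<ge> 1\<close>. So \<open>h \<noteq> 0\<close> at one point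
  would make \<open>\<phi>\<close> negative far to one side of it.\<close>

lemma critical_if_nonpos:
  assumes P: "\<And>x. P x \<le> 0"
  shows "critical (\<lambda>_. 1) c"
proof -
  have const: "\<exists>k>0. \<forall>x. \<phi> x = k * exp (P x)" if "\<phi> \<in> positive_supersolutions (\<lambda>_. 1) c" for \<phi>
  proof -
    have \<phi>: "\<phi> \<in> W21_loc" "\<And>x. \<phi> x > 0" "AE x in lebesgue. op_L (\<lambda>_. 1) c \<phi> x \<le> - 0 * \<phi> x"
      using that by (auto simp: positive_supersolutions_def)
    obtain \<psi> D where \<psi>: "\<And>x. (\<phi> has_real_derivative \<psi> x) (at x)" "continuous_on UNIV \<psi>"
      and D: "\<And>x. (D has_real_derivative - (c x + 0) * \<phi> x) (at x)"
        "\<And>x y. x \<le> y \<Longrightarrow> \<psi> y \<le> \<psi> x + (D y - D x)"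
      by (rule supersolution_derivative[OF \<phi>(1) continuous_c \<phi>(3)]) (rule that; assumption)
    have cont\<phi>: "continuous_on UNIV \<phi>" using \<phi>(1) by (simp add: W21_loc_def)
    define h where "h x = exp (P x) * (\<psi> x - p x * \<phi> x)" for x
    have h_anti: "h y \<le> h x + 0 * (y - x)" if "x \<le> y" for x y
    proof (rule right_majorant_slope_bound[OF _ _ that])
      show "continuous_on UNIV h"
        unfolding h_def by (intro continuous_intros continuous_P continuous_p cont\<phi> \<psi>(2))
      fix x
      \<comment> \<open>\<open>h\<close> with \<open>\<psi> y\<close> replaced by its majorant,
        which is differentiable. At \<open>x\<close> the terms with \<open>p' \<phi>\<close>,
        \<open>p^2 \<phi>\<close> and \<open>p \<psi>\<close> cancel, which leaves slope 0.\<close>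
      let ?e = "\<lambda>y. exp (P y) * (\<psi> x + (D y - D x) - p y * \<phi> y)"
      have "(?e has_real_derivative 0) (at x)"
        by (auto intro!: derivative_eq_intros DERIV_chain2[OF DERIV_exp] DERIV_P DERIV_p D(1) \<psi>(1)
            simp: c_def algebra_simps power2_eq_square)
      moreover have "\<forall>y\<ge>x. h y \<le> ?e y" using D(2) by (auto simp: h_def)
      ultimately show "\<exists>e e'. e x = h x \<and> (\<forall>y\<ge>x. h y \<le> e y) \<and> (e has_real_derivative e') (at x) \<and> e' \<le> 0"
        by (intro exI[of _ ?e] exI[of _ 0]) (auto simp: h_def)
    qed
    define g where "g x = \<phi> x * exp (- P x)" for x
    have e: "exp (P x) * exp (- 2 * P x) = exp (- P x)" for x by (simp flip: exp_add)
    have g: "(g has_real_derivative h x * exp (- 2 * P x)) (at x)" for x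
    proof -
      have "(g has_real_derivative (\<psi> x - p x * \<phi> x) * exp (- P x)) (at x)"
        unfolding g_def by (auto intro!: derivative_eq_intros DERIV_chain2[OF DERIV_exp] DERIV_P \<psi>(1)
            simp: algebra_simps)
      then show ?thesis unfolding h_def e[symmetric] by (simp add: mult_ac)
    qed
    have gpos: "g x > 0" for x using \<phi>(2) by (simp add: g_def)
    have ge1: "exp (- 2 * P x) \<ge> 1" for x using P[of x] by simp
    have "h x = 0" for x
    proof (rule ccontr)
      assume "h x \<noteq> 0"
      \<comment> \<open>The zero of the tangent to \<open>g\<close> at \<open>x\<close>, taken with
        slope \<open>h x\<close>. Between \<open>x\<close> and \<open>y\<close> the monotonicity of
        \<open>h\<close> and the weight \<ge> 1 keep \<open>g\<close> below that line, so
        \<open>g y \<le> 0\<close>.\<close>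
      define y where "y = x - g x / h x"
      have gh: "g y - h x * y \<le> g x - h x * x"
      proof (cases "h x > 0")
        case True
        show ?thesis
        proof (rule DERIV_nonneg_imp_nondecreasing[where f="\<lambda>t. g t - h x * t"])
          show "y \<le> x" using True gpos[of x] by (simp add: y_def less_imp_le)
          fix t assume t: "y \<le> t" "t \<le> x"
          have "h x * 1 \<le> h t * exp (- 2 * P t)"
            using h_anti[OF t(2)] ge1[of t] True by (intro mult_mono) auto
          moreover have "((\<lambda>t. g t - h x * t) has_real_derivative h t * exp (- 2 * P t) - h x) (at t)"
            by (auto intro!: derivative_eq_intros g)
          ultimately show "\<exists>d. ((\<lambda>t. g t - h x * t) has_real_derivative d) (at t) \<and> d \<ge> 0" by force
        qed
      next
        case False
        then have neg: "h x < 0" using \<open>h x \<noteq> 0\<close> by simp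
        show ?thesis
        proof (rule DERIV_nonpos_imp_nonincreasing[where f="\<lambda>t. g t - h x * t"])
          show "x \<le> y" using neg gpos[of x] by (simp add: y_def divide_pos_neg less_imp_le)
          fix t assume t: "x \<le> t" "t \<le> y"
          have "- h x * 1 \<le> - h t * exp (- 2 * P t)"
            using h_anti[OF t(1)] ge1[of t] neg by (intro mult_mono) auto
          moreover have "((\<lambda>t. g t - h x * t) has_real_derivative h t * exp (- 2 * P t) - h x) (at t)"
            by (auto intro!: derivative_eq_intros g)
          ultimately show "\<exists>d. ((\<lambda>t. g t - h x * t) has_real_derivative d) (at t) \<and> d \<le> 0" by force
        qed
      qed
      have "h x * y = h x * x - g x" using \<open>h x \<noteq> 0\<close> by (simp add: y_def field_simps)
      then show False using gh gpos[of y] by simp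
    qed
    then have "(g has_real_derivative 0) (at x)" for x using g[of x] by simp
    then have "g x = g 0" for x using DERIV_const_ratio_const DERIV_isconst_all by blast
    then have "\<phi> x = g 0 * exp (P x)" for x
      by (metis g_def exp_minus_inverse mult.assoc mult.commute mult.right_neutral)
    then show ?thesis using gpos[of 0] by blast
  qed
  show ?thesis unfolding critical_def
  proof (intro conjI ballI)
    show "positive_supersolutions (\<lambda>_. 1) c \<noteq> {}"
      using exp_solution positive_solutions_subset by blast
    fix u v assume "u \<in> positive_supersolutions (\<lambda>_. 1) c" "v \<in> positive_supersolutions (\<lambda>_. 1) c"
    then obtain k l where "k > 0" "\<And>x. u x = k * exp (P x)" "\<And>x. v x = l * exp (P x)"
      using const by metis
    then have "\<forall>x. v x = l / k * u x" by simp
    then show "\<exists>k. \<forall>x. v x = k * u x" by blast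
  qed
qed

text \<open>Split \<open>p = Q' + r\<close> with \<open>Q\<close> bounded and \<open>r\<close> small. The quantity
  \<open>s = exp (2 Q) (\<phi>'/\<phi> - p)\<close> satisfies \<open>s' \<le> - \<delta> (1 + s\<^sup>2)\<close> on the whole line
  if \<open>\<mu> > 0\<close>, so that \<open>arctan s\<close> would be unbounded.\<close>

lemma principal_eigenvalue_eq_0:
  assumes split: "\<And>\<epsilon>. \<epsilon> > 0 \<Longrightarrow> \<exists>Q q B. (\<forall>x. (Q has_real_derivative q x) (at x)) \<and>
      (\<forall>x. \<bar>Q x\<bar> \<le> B) \<and> (\<forall>x. \<bar>p x - q x\<bar> \<le> \<epsilon>)"
  shows "principal_eigenvalue (\<lambda>_. 1) c = 0"
proof -
  have nonpos: "\<mu> \<le> 0" if \<phi>: "\<phi> \<in> W21_loc" "\<And>x. \<phi> x > 0"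
      and super: "AE x in lebesgue. - op_L (\<lambda>_. 1) c \<phi> x \<ge> \<mu> * \<phi> x" for \<mu> \<phi>
  proof (rule ccontr)
    assume "\<not> \<mu> \<le> 0"
    then have \<mu>: "\<mu> > 0" by simp
    \<comment> \<open>Chosen so that \<open>2 \<epsilon> |t| \<le> t^2/2 + 2 \<epsilon>^2\<close>
      has the remainder \<open>\<mu>/2\<close>: the error term then eats only half of
      \<open>\<mu> + t^2\<close>.\<close>
    define \<epsilon> where "\<epsilon> = sqrt \<mu> / 2"
    have \<epsilon>: "\<epsilon> > 0" "\<epsilon>\<^sup>2 = \<mu> / 4" using \<mu> by (auto simp: \<epsilon>_def power_divide)
    obtain Q q B where Q: "\<And>x. (Q has_real_derivative q x) (at x)" "\<And>x. \<bar>Q x\<bar> \<le> B"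
      and pq: "\<And>x. \<bar>p x - q x\<bar> \<le> \<epsilon>"
      using split[OF \<epsilon>(1)] by metis
    have contQ: "continuous_on UNIV Q"
      using Q(1) by (auto intro!: continuous_at_imp_continuous_on DERIV_isCont)
    have cont\<phi>: "continuous_on UNIV \<phi>" using \<phi>(1) by (simp add: W21_loc_def)
    have "AE x in lebesgue. op_L (\<lambda>_. 1) c \<phi> x \<le> - \<mu> * \<phi> x"
      using super by eventually_elim simp
    then obtain \<psi> D where \<psi>: "\<And>x. (\<phi> has_real_derivative \<psi> x) (at x)" "continuous_on UNIV \<psi>"
      and D: "\<And>x. (D has_real_derivative - (c x + \<mu>) * \<phi> x) (at x)"
        "\<And>x y. x \<le> y \<Longrightarrow> \<psi> y \<le> \<psi> x + (D y - D x)"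
      by (rule supersolution_derivative[OF \<phi>(1) continuous_c]) (rule that; assumption)
    \<comment> \<open>Formally \<open>t = \<phi>'/\<phi> - p\<close> satisfies
      \<open>t' \<le> - \<mu> - t^2 - 2 p t\<close>. The last term has no sign; the integrating
      factor \<open>exp (2 Q)\<close> reduces its coefficient \<open>p\<close> to the small
      \<open>p - q\<close>.\<close>
    define s where "s x = exp (2 * Q x) * (\<psi> x / \<phi> x - p x)" for x
    \<comment> \<open>\<open>exp (- 2 * B)\<close> is below both \<open>exp (2 Q)\<close> and
      \<open>exp (- 2 Q)\<close>: the first is for the term with \<open>\<mu>\<close>, the second
      for rewriting \<open>exp (2 Q) t^2\<close> as \<open>exp (- 2 Q) s^2\<close>.\<close>
    define \<delta> where "\<delta> = exp (- 2 * B) * min \<mu> 1 / 2"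
    have \<delta>: "\<delta> > 0" using \<mu> by (simp add: \<delta>_def)
    have "arctan (s y) \<le> arctan (s x) + (- \<delta>) * (y - x)" if "x \<le> y" for x y
    proof (rule right_majorant_slope_bound[OF _ _ that])
      show "continuous_on UNIV (\<lambda>x. arctan (s x))"
        unfolding s_def using \<phi>(2)
        by (intro continuous_intros continuous_on_arctan contQ cont\<phi> continuous_p \<psi>(2)) (metis less_irrefl)
      fix x
      let ?E = "\<lambda>y. exp (2 * Q y) * ((\<psi> x + (D y - D x)) / \<phi> y - p y)"
      define t where "t = \<psi> x / \<phi> x - p x"
      define E' where "E' = exp (2 * Q x) * (2 * q x * t + ((p x)\<^sup>2 - \<mu> - (\<psi> x / \<phi> x)\<^sup>2))"
      have z: "\<psi> x / \<phi> x = t + p x" by (simp add: t_def)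
      have \<phi>x: "\<phi> x \<noteq> 0" using \<phi>(2)[of x] by simp
      have E: "(?E has_real_derivative E') (at x)"
        unfolding E'_def t_def
        by (rule derivative_eq_intros DERIV_chain2[OF DERIV_exp] Q(1) DERIV_p D(1) \<psi>(1) \<phi>x refl)+
          (use \<phi>x in \<open>simp add: c_def field_simps power2_eq_square\<close>)
      have "E' = exp (2 * Q x) * (- \<mu> - t\<^sup>2 - 2 * (p x - q x) * t)"
        unfolding E'_def z by (simp add: algebra_simps power2_eq_square)
      also have "\<dots> \<le> exp (2 * Q x) * (- (\<mu> + t\<^sup>2) / 2)"
      proof (rule mult_left_mono)
        have "- ((p x - q x) * t) \<le> \<epsilon> * \<bar>t\<bar>"
          using mult_right_mono[OF pq[of x], of "\<bar>t\<bar>"] abs_ge_minus_self[of "(p x - q x) * t"]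
          by (simp add: abs_mult)
        then have "- (2 * (p x - q x) * t) \<le> 2 * \<epsilon> * \<bar>t\<bar>"
          by (simp add: algebra_simps)
        also have "\<dots> \<le> t\<^sup>2 / 2 + \<mu> / 2"
          using zero_le_power2[of "\<bar>t\<bar> - 2 * \<epsilon>"] \<epsilon>(2) by (simp add: power2_eq_square algebra_simps)
        finally show "- \<mu> - t\<^sup>2 - 2 * (p x - q x) * t \<le> - (\<mu> + t\<^sup>2) / 2" by (simp add: field_simps)
      qed simp
      also have "\<dots> \<le> - \<delta> * (1 + (s x)\<^sup>2)"
      proof -
        have s: "(s x)\<^sup>2 = exp (2 * Q x) * exp (2 * Q x) * t\<^sup>2"
          by (simp add: s_def t_def power2_eq_square)
        have b: "exp (- 2 * B) \<le> exp (2 * Q x)" "exp (- 2 * B) * exp (2 * Q x) \<le> 1"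
          using Q(2)[of x] by (auto simp flip: exp_add)
        have "exp (- 2 * B) * min \<mu> 1 \<le> exp (2 * Q x) * \<mu>"
          using b(1) \<mu> by (intro mult_mono) auto
        moreover have "exp (- 2 * B) * min \<mu> 1 * (s x)\<^sup>2 \<le> exp (2 * Q x) * t\<^sup>2"
        proof -
          have "exp (- 2 * B) * min \<mu> 1 * (s x)\<^sup>2 \<le> exp (- 2 * B) * 1 * (s x)\<^sup>2"
            by (intro mult_right_mono mult_left_mono) auto
          also have "\<dots> = (exp (- 2 * B) * exp (2 * Q x)) * (exp (2 * Q x) * t\<^sup>2)"
            by (simp add: s mult_ac)
          also have "\<dots> \<le> 1 * (exp (2 * Q x) * t\<^sup>2)" using b(2) by (intro mult_right_mono) auto
          finally show ?thesis by simp
        qed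
        ultimately show ?thesis by (simp add: \<delta>_def algebra_simps)
      qed
      finally have E': "E' \<le> - \<delta> * (1 + (s x)\<^sup>2)" .
      have "((\<lambda>y. arctan (?E y)) has_real_derivative inverse (1 + (s x)\<^sup>2) * E') (at x)"
        using DERIV_chain2[OF DERIV_arctan E] by (simp add: s_def)
      moreover have "\<forall>y\<ge>x. arctan (s y) \<le> arctan (?E y)"
        using D(2) \<phi>(2) by (auto simp: s_def arctan_le_iff less_imp_le intro!: divide_right_mono)
      moreover have "inverse (1 + (s x)\<^sup>2) * E' \<le> - \<delta>"
      proof -
        have "1 + (s x)\<^sup>2 > 0" by (simp add: add_pos_nonneg)
        then show ?thesis using E' by (simp add: field_simps)
      qed
      ultimately show "\<exists>e e'. e x = arctan (s x) \<and> (\<forall>y\<ge>x. arctan (s y) \<le> e y) \<and>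
          (e has_real_derivative e') (at x) \<and> e' \<le> - \<delta>"
        by (intro exI[of _ "\<lambda>y. arctan (?E y)"] exI[of _ "inverse (1 + (s x)\<^sup>2) * E'"])
          (auto simp: s_def)
    qed
    \<comment> \<open>On an interval of length \<open>4 / \<delta>\<close> the arctangent would drop
      by 4, more than its range of length pi allows.\<close>
    from this[of 0 "4 / \<delta>"] have "arctan (s (4 / \<delta>)) \<le> arctan (s 0) - 4" using \<delta> by simp
    then show False
      using arctan_lbound[of "s (4 / \<delta>)"] arctan_ubound[of "s 0"] pi_less_4 by linarith
  qed
  have mem: "0 \<in> {\<mu>. \<exists>\<phi>\<in>W21_loc. (\<forall>x. \<phi> x > 0) \<and> (AE x in lebesgue. - op_L (\<lambda>_. 1) c \<phi> x \<ge> \<mu> * \<phi> x)}"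
    using subsetD[OF positive_solutions_subset exp_solution]
    by (auto simp: positive_supersolutions_def intro!: bexI[of _ "\<lambda>x. exp (P x)"])
  show ?thesis unfolding principal_eigenvalue_def
  proof (rule antisym)
    show "Sup (ereal ` {\<mu>. \<exists>\<phi>\<in>W21_loc. (\<forall>x. \<phi> x > 0) \<and>
        (AE x in lebesgue. - op_L (\<lambda>_. 1) c \<phi> x \<ge> \<mu> * \<phi> x)}) \<le> 0"
      using nonpos by (intro SUP_least) auto
    show "0 \<le> Sup (ereal ` {\<mu>. \<exists>\<phi>\<in>W21_loc. (\<forall>x. \<phi> x > 0) \<and>
        (AE x in lebesgue. - op_L (\<lambda>_. 1) c \<phi> x \<ge> \<mu> * \<phi> x)})"
      by (rule SUP_upper2[OF mem]) simp
  qed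
qed

end

section \<open>The limit-periodic potential\<close>

lemma summable_geometric_bounded:
  fixes r :: real
  assumes "0 \<le> r" "r < 1" "\<And>k. \<bar>s k\<bar> \<le> C"
  shows "summable (\<lambda>k. M * r ^ k * s k)"
proof (rule summable_comparison_test')
  show "summable (\<lambda>k. \<bar>M\<bar> * C * r ^ k)" using assms by (intro summable_mult summable_geometric) auto
  fix k show "norm (M * r ^ k * s k) \<le> \<bar>M\<bar> * C * r ^ k"
    using mult_left_mono[OF assms(3)[of k], of "\<bar>M\<bar> * r ^ k"] assms(1) by (simp add: abs_mult mult_ac)
qed

text \<open>Since \<open>|s k x| \<le> 1\<close>, the error is at most the sum of
  \<open>a k * |\<alpha> n k - \<beta> k|\<close>, free of \<open>x\<close>; it tends to 0 by
  dominated convergence for series. The \<open>\<alpha> n k\<close> will be cosines and sines of the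
  phases of a translation.\<close>

lemma uniform_limit_modulated_series:
  fixes a :: "nat \<Rightarrow> real" and s :: "nat \<Rightarrow> real \<Rightarrow> real"
  assumes a: "summable a" "\<And>k. a k \<ge> 0"
    and \<alpha>: "\<And>n k. \<bar>\<alpha> n k\<bar> \<le> 1" "\<And>k. (\<lambda>n. \<alpha> n k) \<longlonglongrightarrow> \<beta> k"
    and s: "\<And>k x. \<bar>s k x\<bar> \<le> 1"
  shows "uniform_limit UNIV (\<lambda>n x. \<Sum>k. a k * \<alpha> n k * s k x) (\<lambda>x. \<Sum>k. a k * \<beta> k * s k x) sequentially"
    "bounded (range (\<lambda>x. \<Sum>k. a k * \<beta> k * s k x))"
proof -
  have \<beta>: "\<bar>\<beta> k\<bar> \<le> 1" for k
    by (rule tendsto_upperbound[OF tendsto_rabs[OF \<alpha>(2)]]) (use \<alpha>(1) in auto)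
  have sm: "summable (\<lambda>k. a k * \<gamma> k * s k x)" if "\<And>k. \<bar>\<gamma> k\<bar> \<le> 1" for \<gamma> x
  proof (rule summable_comparison_test'[OF a(1)])
    fix k show "norm (a k * \<gamma> k * s k x) \<le> a k"
      using a(2)[of k] that[of k] s[of k x] by (simp add: abs_mult mult.assoc mult_left_le mult_le_one)
  qed
  let ?E = "\<lambda>n. \<Sum>k. a k * \<bar>\<alpha> n k - \<beta> k\<bar>"
  have dom: "norm (a k * \<bar>\<alpha> n k - \<beta> k\<bar>) \<le> a k * 2" for n k
    using a(2)[of k] \<alpha>(1)[of n k] \<beta>[of k] by (auto simp: abs_mult intro!: mult_left_mono)
  have smE: "summable (\<lambda>k. a k * \<bar>\<alpha> n k - \<beta> k\<bar>)" for n
    by (rule summable_comparison_test'[OF summable_mult2[OF a(1)] dom])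
  have "((\<lambda>n. \<Sum>k. a k * \<bar>\<alpha> n k - \<beta> k\<bar>) \<longlongrightarrow> (\<Sum>k. a k * \<bar>\<beta> k - \<beta> k\<bar>)) sequentially"
  proof (rule tannerys_theorem[THEN conjunct2, THEN conjunct2])
    show "\<And>k. (\<lambda>n. a k * \<bar>\<alpha> n k - \<beta> k\<bar>) \<longlonglongrightarrow> a k * \<bar>\<beta> k - \<beta> k\<bar>"
      by (intro tendsto_intros \<alpha>(2))
    show "\<forall>\<^sub>F (k, n) in sequentially \<times>\<^sub>F sequentially. norm (a k * \<bar>\<alpha> n k - \<beta> k\<bar>) \<le> a k * 2"
      using dom by (intro always_eventually) auto
  qed (auto intro: summable_mult2 a(1))
  then have E: "?E \<longlonglongrightarrow> 0" by simp
  have diff: "\<bar>(\<Sum>k. a k * \<alpha> n k * s k x) - (\<Sum>k. a k * \<beta> k * s k x)\<bar> \<le> ?E n" for n x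
  proof -
    have le: "norm (a k * \<alpha> n k * s k x - a k * \<beta> k * s k x) \<le> a k * \<bar>\<alpha> n k - \<beta> k\<bar>" for k
    proof -
      have "norm (a k * \<alpha> n k * s k x - a k * \<beta> k * s k x) = a k * \<bar>\<alpha> n k - \<beta> k\<bar> * \<bar>s k x\<bar>"
        using a(2)[of k] by (simp add: abs_mult flip: left_diff_distrib right_diff_distrib)
      also have "\<dots> \<le> a k * \<bar>\<alpha> n k - \<beta> k\<bar>"
        using a(2)[of k] s[of k x] by (intro mult_left_le) auto
      finally show ?thesis .
    qed
    have "(\<Sum>k. a k * \<alpha> n k * s k x) - (\<Sum>k. a k * \<beta> k * s k x) = (\<Sum>k. a k * \<alpha> n k * s k x - a k * \<beta> k * s k x)"
      using sm[OF \<alpha>(1)] sm[OF \<beta>] by (rule suminf_diff)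
    also have "norm \<dots> \<le> ?E n"
      using le smE by (rule norm_suminf_le)
    finally show ?thesis by simp
  qed
  show "uniform_limit UNIV (\<lambda>n x. \<Sum>k. a k * \<alpha> n k * s k x) (\<lambda>x. \<Sum>k. a k * \<beta> k * s k x) sequentially"
  proof (rule uniform_limitI)
    fix e :: real assume "e > 0"
    with E have "\<forall>\<^sub>F n in sequentially. ?E n < e" by (rule order_tendstoD(2))
    then show "\<forall>\<^sub>F n in sequentially. \<forall>x\<in>UNIV. dist (\<Sum>k. a k * \<alpha> n k * s k x) (\<Sum>k. a k * \<beta> k * s k x) < e"
      by eventually_elim (auto simp: dist_real_def intro: le_less_trans[OF diff])
  qed
  have "norm (\<Sum>k. a k * \<beta> k * s k x) \<le> suminf a" for x
  proof (rule norm_suminf_le[OF _ a(1)])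
    fix k show "norm (a k * \<beta> k * s k x) \<le> a k"
      using a(2)[of k] \<beta>[of k] s[of k x] by (simp add: abs_mult mult.assoc mult_left_le mult_le_one)
  qed
  then show "bounded (range (\<lambda>x. \<Sum>k. a k * \<beta> k * s k x))"
    by (auto simp: bounded_iff)
qed

text \<open>The diagonal extraction is the sequential compactness of a countable product of discs;
  \<open>cis\<close> handles cosine and sine with the same subsequence.\<close>

lemma cis_sequence_convergent_subsequence:
  fixes \<theta> :: "nat \<Rightarrow> nat \<Rightarrow> real"
  obtains r \<alpha> \<beta> where "strict_mono r" "\<And>k. (\<lambda>n. cos (\<theta> (r n) k)) \<longlonglongrightarrow> \<alpha> k"
    "\<And>k. (\<lambda>n. sin (\<theta> (r n) k)) \<longlonglongrightarrow> \<beta> k"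
proof -
  let ?z = "\<lambda>n k. cis (\<theta> n k)"
  have "compactin (product_topology (\<lambda>_::nat. euclidean) UNIV) (PiE UNIV (\<lambda>_. cball (0::complex) 1))"
    by (auto simp: compactin_PiE)
  then have "compact (PiE UNIV (\<lambda>_::nat. cball (0::complex) 1))"
    by (simp add: euclidean_product_topology)
  then have "seq_compact (PiE UNIV (\<lambda>_::nat. cball (0::complex) 1))"
    by (rule compact_imp_seq_compact)
  moreover have "\<forall>n. ?z n \<in> PiE UNIV (\<lambda>_. cball 0 1)" by auto
  ultimately obtain l r where r: "strict_mono r" and l: "(?z \<circ> r) \<longlonglongrightarrow> l"
    by (rule seq_compactE)
  have "(\<lambda>n. ?z (r n) k) \<longlonglongrightarrow> l k" for k
  proof -
    have "continuous_on UNIV (\<lambda>f :: nat \<Rightarrow> complex. f k)" by (rule continuous_on_product_coordinates)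
    from continuous_on_tendsto_compose[OF this l] show ?thesis by (simp add: o_def)
  qed
  then have "(\<lambda>n. cos (\<theta> (r n) k)) \<longlonglongrightarrow> Re (l k)" "(\<lambda>n. sin (\<theta> (r n) k)) \<longlonglongrightarrow> Im (l k)" for k
    using tendsto_Re[of "\<lambda>n. ?z (r n) k" "l k"] tendsto_Im[of "\<lambda>n. ?z (r n) k" "l k"] by auto
  with r show ?thesis by (rule that)
qed

section \<open>The potential and its growth\<close>

definition freq :: "nat \<Rightarrow> real" where "freq k = pi / 3 ^ k"

text \<open>The amplitudes diverge, but for fixed \<open>x\<close> the factor \<open>1 - cos\<close>
  is of order \<open>x^2 / 9^k\<close>, so the series converges pointwise. \<open>P1\<close> and
  \<open>P2\<close> are its termwise derivatives.\<close>

definition P0 :: "real \<Rightarrow> real" where "P0 x = (\<Sum>k. 4 * 2 ^ k * (1 - cos (freq k * x)))"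
definition P1 :: "real \<Rightarrow> real" where "P1 x = (\<Sum>k. 4 * pi * (2/3) ^ k * sin (freq k * x))"
definition P2 :: "real \<Rightarrow> real" where "P2 x = (\<Sum>k. 4 * pi\<^sup>2 * (2/9) ^ k * cos (freq k * x))"

lemma uniformly_convergent_geometric_series:
  fixes r M :: real
  assumes "0 \<le> r" "r < 1" "\<And>k x. \<bar>s k x\<bar> \<le> 1"
  shows "uniformly_convergent_on UNIV (\<lambda>n x::real. \<Sum>k<n. M * r ^ k * s k x)"
proof (rule Weierstrass_m_test')
  show "summable (\<lambda>k. \<bar>M\<bar> * r ^ k)" using assms by (intro summable_mult summable_geometric) auto
  fix k x show "norm (M * r ^ k * s k x) \<le> \<bar>M\<bar> * r ^ k"
    using mult_left_mono[OF assms(3)[of k x], of "\<bar>M\<bar> * r ^ k"] assms(1) by (simp add: abs_mult mult_ac)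
qed

lemma DERIV_P0: "(P0 has_real_derivative P1 x) (at x)"
  and summable_P0: "summable (\<lambda>k. 4 * 2 ^ k * (1 - cos (freq k * x)))"
proof -
  have d: "((\<lambda>x. 4 * 2 ^ k * (1 - cos (freq k * x))) has_real_derivative 4 * pi * (2/3) ^ k * sin (freq k * x)) (at x within UNIV)" for k x
    by (auto intro!: derivative_eq_intros simp: freq_def power_divide)
  have u: "uniformly_convergent_on UNIV (\<lambda>n x::real. \<Sum>k<n. 4 * pi * (2/3) ^ k * sin (freq k * x))"
    by (rule uniformly_convergent_geometric_series) auto
  \<comment> \<open>All terms vanish at 0; convergence at this point and uniform convergence of the
    derivatives give convergence everywhere.\<close>
  have "summable (\<lambda>k. 4 * 2 ^ k * (1 - cos (freq k * 0)))" by simp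
  note * = has_field_derivative_series'[OF convex_UNIV d u UNIV_I this, of x]
  show "(P0 has_real_derivative P1 x) (at x)"
    using *(2) unfolding P0_def[abs_def] P1_def[abs_def] by simp
  show "summable (\<lambda>k. 4 * 2 ^ k * (1 - cos (freq k * x)))" using *(1) by simp
qed

lemma summable_P1: "summable (\<lambda>k. 4 * pi * (2/3) ^ k * sin (freq k * x))"
  by (rule summable_geometric_bounded[where C=1]) auto

lemma summable_P2: "summable (\<lambda>k. 4 * pi\<^sup>2 * (2/9) ^ k * cos (freq k * x))"
  by (rule summable_geometric_bounded[where C=1]) auto

lemma DERIV_P1: "(P1 has_real_derivative P2 x) (at x)"
proof -
  have d: "((\<lambda>x. 4 * pi * (2/3) ^ k * sin (freq k * x)) has_real_derivative 4 * pi\<^sup>2 * (2/9) ^ k * cos (freq k * x)) (at x within UNIV)" for k x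
  proof -
    have "(9::real) ^ k = 3 ^ k * 3 ^ k" by (simp flip: power_mult_distrib)
    then show ?thesis
      by (auto intro!: derivative_eq_intros simp: freq_def power2_eq_square power_divide)
  qed
  have u: "uniformly_convergent_on UNIV (\<lambda>n x::real. \<Sum>k<n. 4 * pi\<^sup>2 * (2/9) ^ k * cos (freq k * x))"
    by (rule uniformly_convergent_geometric_series) auto
  show ?thesis
    using has_field_derivative_series'(2)[OF convex_UNIV d u UNIV_I summable_P1[of 0], of x]
    unfolding P1_def[abs_def] P2_def[abs_def] by simp
qed

lemma continuous_P2: "continuous_on UNIV P2"
proof (rule uniform_limit_theorem)
  have "uniformly_convergent_on UNIV (\<lambda>n x::real. \<Sum>k<n. 4 * pi\<^sup>2 * (2/9) ^ k * cos (freq k * x))"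
    by (rule uniformly_convergent_geometric_series) auto
  then show "uniform_limit UNIV (\<lambda>n x. \<Sum>k<n. 4 * pi\<^sup>2 * (2/9) ^ k * cos (freq k * x)) P2 sequentially"
    unfolding P2_def[abs_def] suminf_eq_lim uniformly_convergent_uniform_limit_iff .
  show "\<forall>\<^sub>F n in sequentially. continuous_on UNIV (\<lambda>x. \<Sum>k<n. 4 * pi\<^sup>2 * (2/9) ^ k * cos (freq k * x))"
    by (intro always_eventually allI continuous_intros)
qed simp

lemma P0_ge_term: "4 * 2 ^ m * (1 - cos (freq m * x)) \<le> P0 x"
  using sum_le_suminf[OF summable_P0, of "{m}" x] by (simp add: P0_def)

lemma P0_nonneg: "P0 x \<ge> 0"
proof -
  have "0 \<le> 4 * 2 ^ 0 * (1 - cos (freq 0 * x))" by simp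
  then show ?thesis using P0_ge_term by (rule order_trans)
qed

text \<open>One term suffices: if \<open>3^(m-1) < |x| \<le> 3^m\<close>, its angle lies between
  pi/3 and pi, so \<open>P0 x \<ge> 2 * 2^m \<ge> 2 (m + 1)\<close> and
  \<open>exp (2 P0 x) \<ge> exp 4 ^ (m+1) \<ge> 9^(m+1)\<close>, while
  \<open>x^2 \<le> 9^m\<close>.\<close>

lemma exp_P0_decay: "exp (- 2 * P0 x) \<le> 2 / (1 + x\<^sup>2)"
proof -
  have pos: "1 + x\<^sup>2 > 0" by (simp add: add_pos_nonneg)
  have "1 + x\<^sup>2 \<le> 2 * exp (2 * P0 x)"
  proof (cases "\<bar>x\<bar> \<le> 1")
    case True
    then have "x\<^sup>2 \<le> 1" by (simp add: abs_square_le_1)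
    moreover have "exp (2 * P0 x) \<ge> 1" using P0_nonneg by simp
    ultimately show ?thesis by linarith
  next
    case False
    define m where "m = (LEAST m. \<bar>x\<bar> \<le> 3 ^ m)"
    have ex: "\<exists>m. \<bar>x\<bar> \<le> 3 ^ m"
      using real_arch_pow[of 3 "\<bar>x\<bar>"] by (auto intro: less_imp_le)
    have le: "\<bar>x\<bar> \<le> 3 ^ m" unfolding m_def using ex by (rule LeastI_ex)
    have "m \<noteq> 0" using le False by (metis power_0)
    then obtain j where j: "m = Suc j" using not0_implies_Suc by blast
    have gt: "\<bar>x\<bar> > 3 ^ j"
      using not_less_Least[of j "\<lambda>m. \<bar>x\<bar> \<le> 3 ^ m"] j by (simp add: m_def)
    have "cos (freq m * \<bar>x\<bar>) \<le> cos (pi / 3)"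
      using le gt j by (intro cos_monotone_0_pi_le) (auto simp: freq_def field_simps)
    moreover have "cos (freq m * \<bar>x\<bar>) = cos (freq m * x)"
      by (cases "x \<ge> 0") auto
    ultimately have "4 * 2 ^ m * (1/2) \<le> 4 * 2 ^ m * (1 - cos (freq m * x))"
      by (intro mult_left_mono) (auto simp: cos_60)
    from order_trans[OF this P0_ge_term] have "2 * 2 ^ m \<le> P0 x" by simp
    moreover have "real (Suc m) \<le> 2 ^ m"
      by (metis Suc_leI less_exp of_nat_le_iff of_nat_numeral of_nat_power)
    ultimately have le4: "4 * real (Suc m) \<le> 2 * P0 x" by simp
    have "(3::real) * 3 \<le> exp 2 * exp 2"
      using exp_ge_add_one_self[of 2] by (intro mult_mono) auto
    then have 9: "(9::real) \<le> exp 4" by (simp flip: exp_add)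
    have ge1: "(1::real) \<le> 9 ^ m" by simp
    have "x\<^sup>2 = \<bar>x\<bar> * \<bar>x\<bar>" by (simp add: power2_eq_square)
    also have "\<dots> \<le> 3 ^ m * 3 ^ m" using le by (intro mult_mono) auto
    also have "\<dots> = 9 ^ m" by (simp flip: power_mult_distrib)
    finally have "1 + x\<^sup>2 \<le> 9 ^ m + 9 ^ m"
      using ge1 by linarith
    also have "\<dots> \<le> 9 ^ Suc m" by simp
    also have "\<dots> \<le> exp 4 ^ Suc m" using 9 by (rule power_mono) simp
    also have "\<dots> = exp (real (Suc m) * 4)" by (rule exp_of_nat_mult[symmetric])
    also have "\<dots> \<le> exp (2 * P0 x)" using le4 by (simp add: mult.commute)
    also have "\<dots> \<le> 2 * exp (2 * P0 x)" by simp
    finally show ?thesis .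
  qed
  then have "exp (- 2 * P0 x) * (1 + x\<^sup>2) \<le> exp (- 2 * P0 x) * (2 * exp (2 * P0 x))"
    by (intro mult_left_mono) auto
  also have "\<dots> = 2" by (simp flip: exp_add)
  finally show ?thesis using pos by (simp add: pos_le_divide_eq)
qed

text \<open>A partial sum has finitely many sines and no constant term, so its primitive is bounded,
  although the bound grows with the number of terms.\<close>

lemma P1_bounded_primitive_approx:
  assumes "\<epsilon> > 0"
  shows "\<exists>Q q B. (\<forall>x. (Q has_real_derivative q x) (at x)) \<and> (\<forall>x. \<bar>Q x\<bar> \<le> B) \<and> (\<forall>x. \<bar>P1 x - q x\<bar> \<le> \<epsilon>)"
proof -
  have "uniformly_convergent_on UNIV (\<lambda>n x::real. \<Sum>k<n. 4 * pi * (2/3) ^ k * sin (freq k * x))"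
    by (rule uniformly_convergent_geometric_series) auto
  then have "uniform_limit UNIV (\<lambda>n x. \<Sum>k<n. 4 * pi * (2/3) ^ k * sin (freq k * x)) P1 sequentially"
    unfolding P1_def[abs_def] suminf_eq_lim uniformly_convergent_uniform_limit_iff .
  then have "\<forall>\<^sub>F n in sequentially. \<forall>x\<in>UNIV. dist (\<Sum>k<n. 4 * pi * (2/3) ^ k * sin (freq k * x)) (P1 x) < \<epsilon>"
    using assms by (rule uniform_limitD)
  then obtain N where N: "\<And>x. dist (\<Sum>k<N. 4 * pi * (2/3) ^ k * sin (freq k * x)) (P1 x) < \<epsilon>"
    by (auto dest!: eventually_happens)
  let ?Q = "\<lambda>x. \<Sum>k<N. - (4 * 2 ^ k * cos (freq k * x))"
  have "(?Q has_real_derivative (\<Sum>k<N. 4 * pi * (2/3) ^ k * sin (freq k * x))) (at x)" for x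
    by (intro DERIV_sum) (auto intro!: derivative_eq_intros simp: freq_def power_divide)
  moreover have "\<bar>?Q x\<bar> \<le> (\<Sum>k<N. 4 * 2 ^ k)" for x
    by (rule order_trans[OF sum_abs], rule sum_mono) (auto simp: abs_mult)
  ultimately show ?thesis using N by (intro exI conjI allI) (auto simp: dist_real_def less_imp_le abs_minus_commute)
qed

interpretation growing: riccati_potential P0 P1 P2
  by unfold_locales (rule DERIV_P0 DERIV_P1 continuous_P2)+

text \<open>Here \<open>c\<close> is \<open>P2 - P1^2\<close>, and the solution
  \<open>exp (- P0)\<close> is at most 1.\<close>

interpretation decaying: riccati_potential "\<lambda>x. - P0 x" "\<lambda>x. - P1 x" "\<lambda>x. - P2 x"
  by unfold_locales (auto intro!: derivative_eq_intros DERIV_P0 DERIV_P1 continuous_intros continuous_P2)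

section \<open>Translates of the potential\<close>

text \<open>The addition theorems separate \<open>x\<close> from the translation, so convergence of
  the countably many phases decides everything. This one lemma yields almost periodicity, the limit
  operator and the boundedness of both potentials.\<close>

lemma translation_limit:
  fixes \<alpha> \<beta> X
  assumes \<alpha>: "\<And>k. (\<lambda>n. cos (freq k * X n)) \<longlonglongrightarrow> \<alpha> k" and \<beta>: "\<And>k. (\<lambda>n. sin (freq k * X n)) \<longlonglongrightarrow> \<beta> k"
  defines "q1 \<equiv> \<lambda>x. (\<Sum>k. 4 * pi * (2/3) ^ k * \<alpha> k * sin (freq k * x)) + (\<Sum>k. 4 * pi * (2/3) ^ k * \<beta> k * cos (freq k * x))"
    and "q2 \<equiv> \<lambda>x. (\<Sum>k. 4 * pi\<^sup>2 * (2/9) ^ k * \<alpha> k * cos (freq k * x)) - (\<Sum>k. 4 * pi\<^sup>2 * (2/9) ^ k * \<beta> k * sin (freq k * x))"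
  shows "uniform_limit UNIV (\<lambda>n x. growing.c (x + X n)) (\<lambda>x. - (q2 x + (q1 x)\<^sup>2)) sequentially"
    "bounded (range (\<lambda>x. - (q2 x + (q1 x)\<^sup>2)))"
proof -
  have a1: "summable (\<lambda>k. 4 * pi * (2/3) ^ k)" and a2: "summable (\<lambda>k. 4 * pi\<^sup>2 * (2/9) ^ k)"
    by (auto intro!: summable_mult summable_geometric)
  note lim1s = uniform_limit_modulated_series[of "\<lambda>k. 4 * pi * (2/3) ^ k" _ _ "\<lambda>k x. sin (freq k * x)", OF a1]
  note lim1c = uniform_limit_modulated_series[of "\<lambda>k. 4 * pi * (2/3) ^ k" _ _ "\<lambda>k x. cos (freq k * x)", OF a1]
  note lim2s = uniform_limit_modulated_series[of "\<lambda>k. 4 * pi\<^sup>2 * (2/9) ^ k" _ _ "\<lambda>k x. sin (freq k * x)", OF a2]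
  note lim2c = uniform_limit_modulated_series[of "\<lambda>k. 4 * pi\<^sup>2 * (2/9) ^ k" _ _ "\<lambda>k x. cos (freq k * x)", OF a2]
  have sm: "summable (\<lambda>k. M * r ^ k * y k * z k)"
    if "0 \<le> r" "r < 1" "\<And>k. \<bar>y k\<bar> \<le> 1" "\<And>k. \<bar>z k\<bar> \<le> 1" for M r :: real and y z
    using summable_geometric_bounded[OF that(1,2), of "\<lambda>k. y k * z k" 1 M] that(3,4)
    by (simp add: mult.assoc abs_mult mult_le_one)
  have P1: "P1 (x + X n) = (\<Sum>k. 4 * pi * (2/3) ^ k * cos (freq k * X n) * sin (freq k * x))
      + (\<Sum>k. 4 * pi * (2/3) ^ k * sin (freq k * X n) * cos (freq k * x))" for x n
  proof -
    have "summable (\<lambda>k. 4 * pi * (2/3) ^ k * cos (freq k * X n) * sin (freq k * x))"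
      "summable (\<lambda>k. 4 * pi * (2/3) ^ k * sin (freq k * X n) * cos (freq k * x))"
      by (rule sm; simp)+
    then show ?thesis
      unfolding P1_def by (simp add: suminf_add sin_add distrib_left algebra_simps)
  qed
  have P2: "P2 (x + X n) = (\<Sum>k. 4 * pi\<^sup>2 * (2/9) ^ k * cos (freq k * X n) * cos (freq k * x))
      - (\<Sum>k. 4 * pi\<^sup>2 * (2/9) ^ k * sin (freq k * X n) * sin (freq k * x))" for x n
  proof -
    have "summable (\<lambda>k. 4 * pi\<^sup>2 * (2/9) ^ k * cos (freq k * X n) * cos (freq k * x))"
      "summable (\<lambda>k. 4 * pi\<^sup>2 * (2/9) ^ k * sin (freq k * X n) * sin (freq k * x))"
      by (rule sm; simp)+
    then show ?thesis
      unfolding P2_def by (simp add: suminf_diff cos_add distrib_left algebra_simps)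
  qed
  have u1: "uniform_limit UNIV (\<lambda>n x. P1 (x + X n)) q1 sequentially"
    unfolding P1 q1_def by (intro uniform_limit_add lim1s lim1c \<alpha> \<beta>) auto
  have u2: "uniform_limit UNIV (\<lambda>n x. P2 (x + X n)) q2 sequentially"
    unfolding P2 q2_def by (intro uniform_limit_minus lim2s lim2c \<alpha> \<beta>) auto
  have b1: "bounded (range q1)"
    unfolding q1_def by (intro bounded_plus_comp lim1s(2)[OF _ _ \<alpha>] lim1c(2)[OF _ _ \<beta>]) auto
  have b2: "bounded (range q2)"
    unfolding q2_def by (intro bounded_minus_comp lim2c(2)[OF _ _ \<alpha>] lim2s(2)[OF _ _ \<beta>]) auto
  \<comment> \<open>Squaring preserves uniform convergence because the limit \<open>q1\<close> is
    bounded.\<close>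
  show "uniform_limit UNIV (\<lambda>n x. growing.c (x + X n)) (\<lambda>x. - (q2 x + (q1 x)\<^sup>2)) sequentially"
    unfolding growing.c_def power2_eq_square
    by (intro uniform_limit_uminus uniform_limit_add uniform_lim_mult u1 u2 b1)
  obtain B1 B2 where B: "\<And>x. \<bar>q1 x\<bar> \<le> B1" "\<And>x. \<bar>q2 x\<bar> \<le> B2"
    using b1 b2 by (auto simp: bounded_iff)
  have "\<bar>- (q2 x + (q1 x)\<^sup>2)\<bar> \<le> B2 + B1\<^sup>2" for x
    using power_mono[OF B(1)[of x], of 2] B(2)[of x] abs_triangle_ineq[of "q2 x" "(q1 x)\<^sup>2"] by simp
  then show "bounded (range (\<lambda>x. - (q2 x + (q1 x)\<^sup>2)))"
    unfolding bounded_iff by auto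
qed

lemma almost_periodic_growing_c: "almost_periodic growing.c"
  unfolding almost_periodic_def
proof
  fix X :: "nat \<Rightarrow> real"
  obtain r \<alpha> \<beta> where "strict_mono r" "\<And>k. (\<lambda>n. cos (freq k * X (r n))) \<longlonglongrightarrow> \<alpha> k"
    "\<And>k. (\<lambda>n. sin (freq k * X (r n))) \<longlonglongrightarrow> \<beta> k"
    by (rule cis_sequence_convergent_subsequence[of "\<lambda>n k. freq k * X n"]) (rule that; assumption)
  then show "\<exists>r. strict_mono r \<and> (\<exists>g. uniform_limit UNIV (\<lambda>k x. growing.c (x + X (r k))) g sequentially)"
    using translation_limit(1)[of "\<lambda>n. X (r n)" \<alpha> \<beta>] by blast
qed

lemma translation_by_power_of_3:
  "(\<lambda>n. growing.c (x + 3 ^ n)) \<longlonglongrightarrow> decaying.c x" "bounded (range growing.c)" "bounded (range decaying.c)"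
proof -
  have "cos (freq k * 3 ^ n) = - 1 \<and> sin (freq k * 3 ^ n) = 0" if "n \<ge> k" for k n
  proof -
    have "(3::real) ^ n = 3 ^ (n - k) * 3 ^ k" using that by (simp flip: power_add)
    then have "freq k * 3 ^ n = real (3 ^ (n - k)) * pi" by (simp add: freq_def)
    moreover have "odd ((3::nat) ^ (n - k))" by simp
    ultimately show ?thesis by (simp only: cos_npi sin_npi) simp
  qed
  then have lim: "(\<lambda>n. cos (freq k * 3 ^ n)) \<longlonglongrightarrow> - 1" "(\<lambda>n. sin (freq k * 3 ^ n)) \<longlonglongrightarrow> 0" for k
    by (auto intro!: tendsto_eventually eventually_sequentiallyI[of k])
  \<comment> \<open>The shape of \<open>translation_limit\<close> with all cosines tending to -1 and
    all sines to 0.\<close>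
  have decaying: "decaying.c = (\<lambda>x. - ((\<Sum>k. 4 * pi\<^sup>2 * (2/9) ^ k * - 1 * cos (freq k * x)) -
      (\<Sum>k. 4 * pi\<^sup>2 * (2/9) ^ k * 0 * sin (freq k * x)) +
      ((\<Sum>k. 4 * pi * (2/3) ^ k * - 1 * sin (freq k * x)) +
      (\<Sum>k. 4 * pi * (2/3) ^ k * 0 * cos (freq k * x)))\<^sup>2))"
    unfolding decaying.c_def
    by (rule ext) (simp add: P1_def P2_def suminf_minus summable_P1 summable_P2)
  note t = translation_limit[OF lim]
  show "(\<lambda>n. growing.c (x + 3 ^ n)) \<longlonglongrightarrow> decaying.c x"
    unfolding decaying using t(1) by (rule tendsto_uniform_limitI) simp
  show "bounded (range decaying.c)" unfolding decaying by (rule t(2))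
  have growing: "growing.c = (\<lambda>x. - ((\<Sum>k. 4 * pi\<^sup>2 * (2/9) ^ k * 1 * cos (freq k * x)) -
      (\<Sum>k. 4 * pi\<^sup>2 * (2/9) ^ k * 0 * sin (freq k * x)) +
      ((\<Sum>k. 4 * pi * (2/3) ^ k * 1 * sin (freq k * x)) +
      (\<Sum>k. 4 * pi * (2/3) ^ k * 0 * cos (freq k * x)))\<^sup>2))"
    unfolding growing.c_def by (rule ext) (simp add: P1_def P2_def)
  \<comment> \<open>The constant sequence 0 makes \<open>growing.c\<close> its own translation
    limit, so its boundedness is that of a limit.\<close>
  have "(\<lambda>n::nat. cos (freq k * 0)) \<longlonglongrightarrow> 1" "(\<lambda>n::nat. sin (freq k * 0)) \<longlonglongrightarrow> 0" for k by auto
  then show "bounded (range growing.c)"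
    unfolding growing by (rule translation_limit(2)[where X="\<lambda>_. 0"])
qed

lemma elliptic_operator_1:
  assumes "continuous_on UNIV c" "bounded (range c)"
  shows "elliptic_operator (\<lambda>_. 1) c"
  using assms by (simp add: elliptic_operator_def smooth_const continuous_lebesgue_measurable)

theorem mainTheorem4:
  shows "\<exists>A c :: real \<Rightarrow> real.
    elliptic_operator A c \<and>
    almost_periodic_operator A c \<and>
    subcritical A c \<and>
    principal_eigenvalue A c = 0 \<and>
    (\<exists>A' c' :: real \<Rightarrow> real.
       limit_operator A c A' c' \<and> elliptic_operator A' c' \<and> critical A' c')"
proof (intro exI conjI)
  show "elliptic_operator (\<lambda>_. 1) growing.c" "elliptic_operator (\<lambda>_. 1) decaying.c"
    using elliptic_operator_1 growing.continuous_c decaying.continuous_c translation_by_power_of_3(2,3) by blast+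
  have "almost_periodic (\<lambda>_. 1)"
    unfolding almost_periodic_def using strict_mono_id uniform_limit_const by blast
  then show "almost_periodic_operator (\<lambda>_. 1) growing.c"
    by (simp add: almost_periodic_operator_def almost_periodic_growing_c)
  show "subcritical (\<lambda>_. 1) growing.c"
    using exp_P0_decay by (rule growing.subcritical_if_integrable)
  show "principal_eigenvalue (\<lambda>_. 1) growing.c = 0"
    using P1_bounded_primitive_approx by (rule growing.principal_eigenvalue_eq_0)
  show "limit_operator (\<lambda>_. 1) growing.c (\<lambda>_. 1) decaying.c"
    unfolding limit_operator_def using translation_by_power_of_3(1) by (intro exI[of _ "\<lambda>n. 3 ^ n"]) auto
  show "critical (\<lambda>_. 1) decaying.c"
    using P0_nonneg by (intro decaying.critical_if_nonpos) simp
qed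

end
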